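(* Let $(f(p))_{p}$, indexed by the prime numbers $p$, be independent random variables with $\mathbb{P}(f(p)=1)=\mathbb{P}(f(p)=-1)=1/2$, and define the Rademacher random multiplicative function $f$ on the positive integers by $f(n)=\mu^2(n)\prod_{p\mid n}f(p)$, where $\mu$ is the Möbius function (so $f(1)=1$ and $f(n)=0$ if $n$ is not squarefree). Then for each real $\alpha$ with $0\leq\alpha\leq 1/2$, almost surely the partial sums $M_\alpha(x)=\sum_{n\leq x}\frac{f(n)}{n^\alpha}$ change sign infinitely often as $x\to\infty$, i.e. almost surely there is no $x_0$ such that $M_\alpha(x)\geq 0$ for all $x\geq x_0$, and no $x_0$ such that $M_\alpha(x)\leq 0$ for all $x\geq x_0$.
   Context: A function $M(x)$ is said to change sign infinitely often as $x\to\infty$ if for every $x_0$, $M(x)$ is neither non-negative for all $x\geq x_0$ nor non-positive for all $x\geq x_0$. *)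

theory Defs
  imports "HOL-Probability.Probability" "HOL-Computational_Algebra.Squarefree"
begin

definition moebius_mu :: "nat \<Rightarrow> real" where
  "moebius_mu n = (if squarefree n then (- 1) ^ card (prime_factors n) else 0)"

text \<open>A family \<open>X\<close> of random variables, of which only the values at primes are used, is
  extended to a random multiplicative function supported on the squarefree numbers.\<close>

definition random_mult :: "(nat \<Rightarrow> 'a \<Rightarrow> real) \<Rightarrow> nat \<Rightarrow> 'a \<Rightarrow> real" where
  "random_mult X n \<omega> = (moebius_mu n)\<^sup>2 * (\<Prod>p\<in>prime_factors n. X p \<omega>)"

definition weighted_partial_sum :: "(nat \<Rightarrow> real) \<Rightarrow> real \<Rightarrow> real \<Rightarrow> real" where
  "weighted_partial_sum f \<alpha> x = (\<Sum>n = 1..nat \<lfloor>x\<rfloor>. f n / real n powr \<alpha>)"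

definition changes_sign_infinitely_often :: "(real \<Rightarrow> real) \<Rightarrow> bool" where
  "changes_sign_infinitely_often F \<longleftrightarrow>
     (\<forall>x0. \<not> (\<forall>x\<ge>x0. F x \<ge> 0) \<and> \<not> (\<forall>x\<ge>x0. F x \<le> 0))"

end

theory Submission
  imports Defs
begin

text \<open>
  Put \<open>\<beta> = 1/2 - \<alpha>\<close>, let \<open>M\<close> be the partial sum in question and \<open>F\<close> the random Euler product. By
  partial summation, \<open>F (1/2 + s)\<close> is the sum of \<open>M n * (n powr -(\<beta>+s) - (n+1) powr -(\<beta>+s))\<close>. If
  \<open>M\<close> has eventually constant sign, then, since each weight divided by \<open>\<beta> + s\<close> decreases in \<open>s\<close>,
  the ratio \<open>F (1/2 + s) / F (1/2 + K * s)\<close> is bounded from below (if \<open>M \<ge> 0\<close>) or from above (if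
  \<open>M \<le> 0\<close>) by positive constants for small \<open>s > 0\<close>, up to an error of order \<open>s\<close> in the numerator; that
  error is negligible because \<open>F (1/2 + s)\<close> is at least of order \<open>s powr (3/4)\<close> with high probability.
  On the other hand, the logarithm of the ratio is a bounded deterministic term plus a sum of
  independent terms \<open>b p * f p\<close> whose variance is bounded away from \<open>0\<close> and infinity. Along very
  sparse scales \<open>s\<close> these sums live on essentially disjoint blocks of primes, so by the
  Paley--Zygmund inequality and the Borel 0-1 law they exceed any constant in both directions
  infinitely often.

  No limit of Euler products is ever taken: the product is cut at a prime bound \<open>y\<close>, the partial
  summation at a much larger \<open>N\<close>, and the two are compared in mean square.
\<close>

section \<open>Squarefree numbers and sums over primes\<close>

definition primes_in :: "nat \<Rightarrow> nat \<Rightarrow> nat set" where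
  "primes_in a b = {p. prime p \<and> a < p \<and> p \<le> b}"

definition sqf :: "nat set \<Rightarrow> nat set" where
  "sqf B = {n. squarefree n \<and> prime_factors n \<subseteq> B}"

lemma finite_primes_in [simp, intro]: "finite (primes_in a b)"
  by (rule finite_subset[of _ "{..b}"]) (auto simp: primes_in_def)

lemma primes_inD: "p \<in> primes_in a b \<Longrightarrow> prime p" "p \<in> primes_in a b \<Longrightarrow> a < p"
    "p \<in> primes_in a b \<Longrightarrow> p \<le> b"
  by (auto simp: primes_in_def)

lemma primes_in_ge_2: "p \<in> primes_in a b \<Longrightarrow> 2 \<le> p"
  by (auto simp: primes_in_def dest: prime_ge_2_nat)

lemma primes_in_split:
  assumes "a \<le> b" "b \<le> c"
  shows "primes_in a c = primes_in a b \<union> primes_in b c" "primes_in a b \<inter> primes_in b c = {}"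
  using assms by (auto simp: primes_in_def)

lemma prime_factors_prod_primes:
  assumes "finite A" "\<And>p. p \<in> A \<Longrightarrow> prime (p::nat)"
  shows "prime_factors (\<Prod>A) = A"
  using assms
proof (induction rule: finite_induct)
  case (insert p A)
  then have "p \<noteq> 0" "\<Prod>A \<noteq> 0" using not_prime_0 by (metis insertI1, metis insertI2 prod_zero_iff)
  then show ?case using insert by (simp add: prime_factors_product prime_prime_factors)
qed simp

lemma squarefree_prod_primes:
  assumes "\<And>p. p \<in> A \<Longrightarrow> prime (p::nat)"
  shows "squarefree (\<Prod>A)"
  using assms by (intro squarefree_prod_coprime) (auto simp: primes_coprime squarefree_prime)

lemma prod_prime_factors_squarefree:
  assumes "squarefree (n::nat)"
  shows "\<Prod>(prime_factors n) = n"
proof -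
  have n0: "n \<noteq> 0" using assms not_squarefree_0 by metis
  have "(\<Prod>p\<in>prime_factors n. p ^ multiplicity p n) = (\<Prod>p\<in>prime_factors n. p)"
    using assms n0 by (intro prod.cong) (auto simp: squarefree_factorial_semiring')
  then show ?thesis using prod_prime_factors[OF n0] by simp
qed

text \<open>A squarefree number is determined by its set of prime factors, so expanding a product
  over \<open>B\<close> by subsets amounts to summing over \<open>sqf B\<close>.\<close>

lemma bij_betw_sqf:
  assumes "finite B" "\<And>p. p \<in> B \<Longrightarrow> prime p"
  shows "bij_betw prime_factors (sqf B) (Pow B)"
proof (rule bij_betwI[where g = "\<lambda>A. \<Prod>A"])
  show "(\<lambda>A. \<Prod>A) \<in> Pow B \<rightarrow> sqf B"
  proof
    fix A assume "A \<in> Pow B"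
    then have "A \<subseteq> B" "finite A" using assms(1) finite_subset by auto
    with assms(2) have "\<And>p. p \<in> A \<Longrightarrow> prime p" by blast
    then show "\<Prod>A \<in> sqf B"
      using \<open>A \<subseteq> B\<close> \<open>finite A\<close> prime_factors_prod_primes[of A] squarefree_prod_primes[of A]
      by (simp add: sqf_def)
  qed
  fix A assume "A \<in> Pow B"
  then have "A \<subseteq> B" "finite A" using assms(1) finite_subset by auto
  with assms(2) show "prime_factors (\<Prod>A) = A" by (intro prime_factors_prod_primes) auto
qed (auto simp: sqf_def prod_prime_factors_squarefree)

lemma finite_sqf [intro]:
  assumes "finite B" "\<And>p. p \<in> B \<Longrightarrow> prime p"
  shows "finite (sqf B)"
  using bij_betw_finite[OF bij_betw_sqf[OF assms]] assms(1) by simp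

lemma prod_one_plus_eq_sum_sqf:
  fixes u :: "nat \<Rightarrow> real"
  assumes "finite B" "\<And>p. p \<in> B \<Longrightarrow> prime p"
  shows "(\<Prod>p\<in>B. 1 + u p) = (\<Sum>n\<in>sqf B. \<Prod>p\<in>prime_factors n. u p)"
proof -
  have "(\<Prod>p\<in>B. 1 + u p) = (\<Prod>p\<in>B. u p + 1)" by (simp add: add.commute)
  also have "\<dots> = (\<Sum>A\<in>Pow B. \<Prod>p\<in>A. u p)" by (subst prod_add[OF assms(1)]) simp
  also have "\<dots> = (\<Sum>n\<in>sqf B. \<Prod>p\<in>prime_factors n. u p)"
    by (rule sum.reindex_bij_betw[OF bij_betw_sqf[OF assms], symmetric])
  finally show ?thesis .
qed

lemma prod_prime_factors_powr:
  assumes "squarefree n"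
  shows "(\<Prod>p\<in>prime_factors n. real p powr s) = real n powr s"
proof -
  have "(\<Prod>p\<in>prime_factors n. real p powr s) = (\<Prod>p\<in>prime_factors n. real p) powr s"
    by (simp add: prod_powr_distrib)
  also have "(\<Prod>p\<in>prime_factors n. real p) = real (\<Prod>(prime_factors n))" by simp
  finally show ?thesis using prod_prime_factors_squarefree[OF assms] by simp
qed

lemma sqf_le_subset: "{n. squarefree n \<and> n \<le> y} \<subseteq> sqf (primes_in 0 y)"
proof
  fix n assume "n \<in> {n. squarefree n \<and> n \<le> y}"
  then have n: "squarefree n" "n \<le> y" "n \<noteq> 0" using not_squarefree_0[where 'a=nat] by (auto simp del: not_squarefree_0 intro!: gr0I)
  have "p \<in> primes_in 0 y" if "p \<in> prime_factors n" for p
    using that n dvd_imp_le[of p n] prime_gt_0_nat[of p] by (auto simp: primes_in_def in_prime_factors_iff)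
  then show "n \<in> sqf (primes_in 0 y)" using n by (auto simp: sqf_def)
qed

section \<open>Power sums compared with integrals\<close>

lemma powr_diff_bounds:
  fixes t x :: real
  assumes "0 < t" "0 < x"
  shows "x powr (-t) - (x+1) powr (-t) \<le> t * x powr (-1-t)"
    and "t * (x+1) powr (-1-t) \<le> x powr (-t) - (x+1) powr (-t)"
proof -
  have "\<exists>z. x < z \<and> z < x+1 \<and> - ((x+1) powr (-t)) - (- (x powr (-t))) = ((x+1) - x) * (t * z powr (-1-t))"
    using assms
    by (intro MVT2[where f="\<lambda>x. - (x powr (-t))"]) 
       (auto intro!: derivative_eq_intros simp: algebra_simps minus_diff_commute)
  then obtain z where z: "x < z" "z < x+1" "x powr (-t) - (x+1) powr (-t) = t * z powr (-1-t)" by auto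
  have "z powr (-1-t) \<le> x powr (-1-t)" "(x+1) powr (-1-t) \<le> z powr (-1-t)"
    using z assms by (auto intro!: powr_mono2')
  then show "x powr (-t) - (x+1) powr (-t) \<le> t * x powr (-1-t)"
    and "t * (x+1) powr (-1-t) \<le> x powr (-t) - (x+1) powr (-t)"
    using z assms by auto
qed

text \<open>Each term is at most \<open>1 / t\<close> times a decrement of
  \<open>n powr (-t)\<close>, and the decrements telescope. The set \<open>S\<close> is arbitrary,
  so that the bound serves primes and squarefree numbers alike.\<close>

lemma sum_powr_tail_le:
  fixes t :: real
  assumes t: "0 < t" and N: "0 < N" and S: "finite S" "\<And>n. n \<in> S \<Longrightarrow> N < n"
  shows "(\<Sum>n\<in>S. real n powr (-1-t)) \<le> real N powr (-t) / t"
proof -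
  have *: "(\<Sum>n\<in>{N<..N+k}. real n powr (-1-t)) \<le> (real N powr (-t) - real (N+k) powr (-t)) / t" for k
  proof (induction k)
    case (Suc k)
    have "t * real (N + Suc k) powr (-1-t) \<le> real (N+k) powr (-t) - real (N + Suc k) powr (-t)"
      using powr_diff_bounds(2)[OF t, of "real (N+k)"] N by (simp add: ac_simps)
    then have "real (N + Suc k) powr (-1-t) \<le> (real (N+k) powr (-t) - real (N + Suc k) powr (-t)) / t"
      using t by (simp add: field_simps)
    moreover have "{N<..N + Suc k} = insert (N + Suc k) {N<..N+k}" by auto
    ultimately show ?case using Suc by (simp add: diff_divide_distrib)
  qed simp
  obtain m where m: "\<And>n. n \<in> S \<Longrightarrow> n \<le> m" using S(1) finite_nat_set_iff_bounded_le by auto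
  have "(\<Sum>n\<in>S. real n powr (-1-t)) \<le> (\<Sum>n\<in>{N<..N+m}. real n powr (-1-t))"
    using S m by (intro sum_mono2) (auto simp: trans_le_add2)
  also have "\<dots> \<le> (real N powr (-t) - real (N+m) powr (-t)) / t" by (rule *)
  also have "\<dots> \<le> real N powr (-t) / t" using t by (intro divide_right_mono) auto
  finally show ?thesis .
qed

lemma sum_powr_le:
  fixes t :: real
  assumes t: "0 < t" and S: "finite S" "0 \<notin> S"
  shows "(\<Sum>n\<in>S. real n powr (-1-t)) \<le> 1 + 1 / t"
proof -
  have "(\<Sum>n\<in>S. real n powr (-1-t)) \<le> (\<Sum>n\<in>insert 1 (S - {1}). real n powr (-1-t))"
    using S by (intro sum_mono2) auto
  also have "\<dots> = 1 + (\<Sum>n\<in>S-{1}. real n powr (-1-t))" using S by (subst sum.insert) auto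
  also have "(\<Sum>n\<in>S-{1}. real n powr (-1-t)) \<le> real 1 powr (-t) / t"
    by (rule sum_powr_tail_le) (use S t in \<open>auto intro: Suc_lessI gr0I\<close>)
  finally show ?thesis by simp
qed

lemma sum_powr_ge:
  fixes t :: real
  assumes t: "0 < t"
  shows "(1 - real (Suc y) powr (-t)) / t \<le> (\<Sum>n=1..y. real n powr (-1-t))"
proof (induction y)
  case (Suc y)
  have "real (Suc y) powr (-t) - real (Suc (Suc y)) powr (-t) \<le> t * real (Suc y) powr (-1-t)"
    using powr_diff_bounds(1)[OF t, of "real (Suc y)"] by (simp add: ac_simps)
  then have "(real (Suc y) powr (-t) - real (Suc (Suc y)) powr (-t)) / t \<le> real (Suc y) powr (-1-t)"
    using t by (simp add: field_simps)
  then show ?case using Suc by (simp add: diff_divide_distrib)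
qed simp

section \<open>Sums over primes near the edge of convergence\<close>

definition prime_sum :: "nat \<Rightarrow> real \<Rightarrow> real" where
  "prime_sum y t = (\<Sum>p\<in>primes_in 0 y. real p powr (-1-t))"

lemma prod_primes_powr:
  "(\<Prod>p\<in>primes_in 0 y. 1 + real p powr s) = (\<Sum>n\<in>sqf (primes_in 0 y). real n powr s)"
  by (subst prod_one_plus_eq_sum_sqf)
     (auto simp: primes_inD sqf_def intro!: sum.cong prod_prime_factors_powr)

lemma zero_notin_sqf: "0 \<notin> sqf B" by (simp add: sqf_def)

lemma finite_sqf_primes_in [simp, intro]: "finite (sqf (primes_in a b))"
  by (intro finite_sqf) (auto simp: primes_inD)

lemma sum_primes_square_le: "(\<Sum>p\<in>primes_in a y. real p powr (-2)) \<le> 2"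
  using sum_powr_le[of 1 "primes_in a y"] by (simp add: primes_in_def)

text \<open>Since \<open>x \<le> ln (1 + x) + x^2\<close>, the sum is at most the logarithm of a
  finite Euler product plus a sum of squares. The product is a sum over squarefree numbers, at most
  \<open>1 + 1 / t \<le> 2 / t\<close>. The constant 3 absorbs \<open>ln 2\<close> and the squares,
  and nothing depends on \<open>y\<close>.\<close>

lemma prime_sum_le:
  assumes t: "0 < t" "t \<le> 1"
  shows "prime_sum y t \<le> ln (1 / t) + 3"
proof -
  have "prime_sum y t \<le> (\<Sum>p\<in>primes_in 0 y. ln (1 + real p powr (-1-t)) + real p powr (-2))"
    unfolding prime_sum_def
  proof (rule sum_mono)
    fix p assume "p \<in> primes_in 0 y"
    then have p: "2 \<le> real p" using primes_in_ge_2[of p 0 y] by simp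
    define x where "x = real p powr (-1-t)"
    have "x \<le> real p powr (-1)" using p t unfolding x_def by (intro powr_mono) auto
    then have x: "0 \<le> x" "x \<le> real p powr (-1)" "x \<le> 1" using p powr_mono[of "-1-t" 0 "real p"] t
      by (auto simp: x_def)
    have "x\<^sup>2 \<le> (real p powr (-1))\<^sup>2" using x by (intro power_mono) auto
    also have "\<dots> = real p powr (-2)" by (simp only: power2_eq_square powr_add[symmetric]) simp
    finally show "x \<le> ln (1 + x) + real p powr (-2)"
      using ln_one_plus_pos_lower_bound[of x] x by linarith
  qed
  also have "\<dots> = ln (\<Prod>p\<in>primes_in 0 y. 1 + real p powr (-1-t)) + (\<Sum>p\<in>primes_in 0 y. real p powr (-2))"
    by (subst ln_prod) (auto simp: sum.distrib add_pos_nonneg order.strict_implies_not_eq[symmetric])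
  also have "(\<Prod>p\<in>primes_in 0 y. 1 + real p powr (-1-t)) \<le> 1 + 1 / t"
    unfolding prod_primes_powr using t by (intro sum_powr_le) (auto simp: zero_notin_sqf)
  then have "ln (\<Prod>p\<in>primes_in 0 y. 1 + real p powr (-1-t)) \<le> ln (1 + 1/t)"
    by (subst ln_le_cancel_iff) (use t in \<open>auto intro!: prod_pos add_pos_nonneg\<close>)
  also have "ln (1 + 1/t) \<le> ln (2 * (1/t))" using t by (subst ln_le_cancel_iff) (auto simp: field_simps)
  also have "\<dots> = ln 2 + ln (1/t)" using t by (intro ln_mult_pos) auto
  finally show ?thesis using sum_primes_square_le[of 0 y] ln_2_less_1 by linarith
qed

text \<open>Every \<open>n\<close> is uniquely a squarefree number times a square. After enlarging
  the index set, the sum factors into a squarefree sum and a sum over the square parts, which is at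
  most 2.\<close>

lemma sum_powr_le_sqf:
  assumes t: "0 < t"
  shows "(\<Sum>n=1..y. real n powr (-1-t)) \<le> 2 * (\<Sum>n\<in>sqf (primes_in 0 y). real n powr (-1-t))"
proof -
  define Q where "Q = {n. squarefree n \<and> n \<le> y}"
  have finQ: "finite Q" by (rule finite_subset[of _ "{..y}"]) (auto simp: Q_def)
  let ?f = "\<lambda>n::nat. (squarefree_part n, square_part n)"
  have inj: "inj_on ?f {1..y}" by (rule inj_onI) (metis prod.inject squarefree_decompose)
  have le: "squarefree_part n \<le> y \<and> square_part n \<le> y \<and> 1 \<le> square_part n" if "n \<in> {1..y}" for n
  proof -
    have n: "n = squarefree_part n * square_part n ^ 2" by (rule squarefree_decompose)
    then have "squarefree_part n dvd n" "square_part n dvd n"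
      by (metis dvd_triv_left, metis dvd_trans dvd_triv_right dvd_power zero_less_numeral)
    then show ?thesis using that dvd_imp_le[of _ n] by (fastforce simp: Suc_le_eq intro: gr0I)
  qed
  have "(\<Sum>n=1..y. real n powr (-1-t)) = 
        (\<Sum>n=1..y. (\<lambda>(a,b). real a powr (-1-t) * real b powr (-2-2*t)) (?f n))"
  proof (rule sum.cong)
    fix n assume "n \<in> {1..y}"
    then have "square_part n > 0" using le[of n] by auto
    then have "(real (square_part n) ^ 2) powr (-1-t) = real (square_part n) powr (-2-2*t)"
      by (simp add: powr_powr flip: powr_numeral)
    moreover have "real n = real (squarefree_part n) * real (square_part n) ^ 2"
      by (metis squarefree_decompose of_nat_mult of_nat_power)
    then have "real n powr (-1-t) = real (squarefree_part n) powr (-1-t) * (real (square_part n) ^ 2) powr (-1-t)"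
      by (simp add: powr_mult)
    ultimately show "real n powr (-1-t) = (\<lambda>(a,b). real a powr (-1-t) * real b powr (-2-2*t)) (?f n)"
      by simp
  qed simp
  also have "\<dots> = (\<Sum>(a,b)\<in>?f ` {1..y}. real a powr (-1-t) * real b powr (-2-2*t))"
    by (subst sum.reindex[OF inj]) simp
  also have "\<dots> \<le> (\<Sum>(a,b)\<in>Q \<times> {1..y}. real a powr (-1-t) * real b powr (-2-2*t))"
    using finQ le by (intro sum_mono2) (auto simp: Q_def)
  also have "\<dots> = (\<Sum>a\<in>Q. real a powr (-1-t)) * (\<Sum>b\<in>{1..y}. real b powr (-2-2*t))"
    by (simp add: sum_product sum.cartesian_product)
  also have "\<dots> \<le> (\<Sum>a\<in>Q. real a powr (-1-t)) * 2"
  proof (rule mult_left_mono)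
    have "(\<Sum>b\<in>{1..y}. real b powr (-2-2*t)) \<le> (\<Sum>b\<in>{1..y}. real b powr (-1-1))"
      using t by (intro sum_mono powr_mono) auto
    also have "\<dots> \<le> 1 + 1 / 1" by (rule sum_powr_le) auto
    finally show "(\<Sum>b\<in>{1..y}. real b powr (-2-2*t)) \<le> 2" by simp
  qed (auto intro: sum_nonneg)
  also have "(\<Sum>a\<in>Q. real a powr (-1-t)) \<le> (\<Sum>n\<in>sqf (primes_in 0 y). real n powr (-1-t))"
    using sqf_le_subset[of y] by (intro sum_mono2) (auto simp: Q_def)
  finally show ?thesis by simp
qed

lemma tendsto_nat_powr_neg: "0 < t \<Longrightarrow> (\<lambda>y. real y powr (-t)) \<longlonglongrightarrow> 0"
  by (rule tendsto_neg_powr) (auto simp: filterlim_real_sequentially)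

text \<open>The logarithm of the same Euler product, now with \<open>ln (1 + x) \<le> x\<close>. The
  claim is for large \<open>y\<close>, since the truncated sum over integers must first reach
  \<open>1 / (2 * t)\<close>; passing to squarefree numbers halves it, and \<open>ln 4\<close> is
  below 3.\<close>

lemma prime_sum_ge:
  assumes t: "0 < t" "t \<le> 1"
  shows "\<forall>\<^sub>F y in sequentially. ln (1 / t) - 3 \<le> prime_sum y t"
proof -
  have "(\<lambda>y. real (Suc y) powr (-t)) \<longlonglongrightarrow> 0"
    using tendsto_nat_powr_neg[OF t(1)] by (rule LIMSEQ_Suc)
  then have "\<forall>\<^sub>F y in sequentially. real (Suc y) powr (-t) < 1/2"
    by (rule order_tendstoD) simp
  then show ?thesis
  proof eventually_elim
    case (elim y)
    let ?S = "\<Sum>n\<in>sqf (primes_in 0 y). real n powr (-1-t)"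
    have "(1/2) / t \<le> (1 - real (Suc y) powr (-t)) / t"
      using elim t by (intro divide_right_mono) auto
    also have "\<dots> \<le> 2 * ?S" using sum_powr_ge[OF t(1), of y] sum_powr_le_sqf[OF t(1), of y] by linarith
    finally have S: "1/(4*t) \<le> ?S" using t by (simp add: field_simps)
    have "ln (1/t) - ln 4 = ln (1/(4*t))" using t by (simp add: ln_div ln_mult)
    also have "\<dots> \<le> ln ?S" using S t by (subst ln_le_cancel_iff) (auto intro: less_le_trans[of _ "1/(4*t)"])
    also have "\<dots> = (\<Sum>p\<in>primes_in 0 y. ln (1 + real p powr (-1-t)))"
      unfolding prod_primes_powr[symmetric] by (subst ln_prod) (auto simp: add_pos_nonneg order.strict_implies_not_eq[symmetric])
    also have "\<dots> \<le> prime_sum y t" unfolding prime_sum_def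
      by (intro sum_mono ln_add_one_self_le_self) auto
    finally have "ln (1/t) - ln 4 \<le> prime_sum y t" .
    moreover have "ln (4::real) = ln 2 + ln 2" using ln_mult_pos[of 2 "2::real"] by simp
    ultimately show ?case using ln_2_less_1 by linarith
  qed
qed

section \<open>Real inequalities\<close>

text \<open>The logarithm of an Euler factor is exactly affine in the sign, so that no Taylor errors arise.\<close>
lemma ln_one_plus_sign:
  fixes x :: real
  assumes "0 \<le> x" "x < 1" "e = 1 \<or> e = -1"
  shows "ln (1 + e * x) = ln (1 - x\<^sup>2) / 2 + e * artanh x"
proof -
  have "1 - x\<^sup>2 = (1 - x) * (1 + x)" by (simp add: power2_eq_square algebra_simps)
  then have "ln (1 - x\<^sup>2) = ln (1 - x) + ln (1 + x)" using assms by (simp add: ln_mult)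
  moreover have "artanh x = (ln (1 + x) - ln (1 - x)) / 2"
    using assms by (simp add: artanh_def ln_div)
  ultimately show ?thesis using assms(3) by (auto simp: field_simps)
qed

text \<open>The derivative \<open>1 / (1 - y^2)\<close> of \<open>artanh\<close> lies between 1 and
  2 on this range. The values \<open>pw t p\<close> with \<open>t \<ge> 0\<close> stay in the range
  even for the prime 2.\<close>

lemma artanh_diff_bounds:
  fixes x z :: real
  assumes "0 \<le> z" "z \<le> x" "x\<^sup>2 \<le> 1/2"
  shows "x - z \<le> artanh x - artanh z" "artanh x - artanh z \<le> 2 * (x - z)"
proof -
  have "x - z \<le> artanh x - artanh z \<and> artanh x - artanh z \<le> 2 * (x - z)"
  proof (cases "z = x")
    case False
    then have zx: "z < x" using assms by simp
    have x1: "x < 1" using assms one_le_power[of x 2] by linarith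
    have "\<exists>y. z < y \<and> y < x \<and> artanh x - artanh z = (x - z) * (1 / (1 - y\<^sup>2))"
      using zx assms x1 by (intro MVT2) (auto intro!: derivative_eq_intros)
    then obtain y where y: "z < y" "y < x" "artanh x - artanh z = (x - z) * (1 / (1 - y\<^sup>2))" by auto
    have "y\<^sup>2 \<le> x\<^sup>2" using y assms by (intro power_mono) auto
    then have "y\<^sup>2 \<le> 1/2" using assms by simp
    then have "1 \<le> 1 / (1 - y\<^sup>2)" "1 / (1 - y\<^sup>2) \<le> 2" by (auto simp: field_simps)
    then show ?thesis using y(3) zx
      mult_left_mono[of 1 "1 / (1 - y\<^sup>2)" "x - z"] mult_left_mono[of "1 / (1 - y\<^sup>2)" 2 "x - z"] by simp
  qed simp
  then show "x - z \<le> artanh x - artanh z" "artanh x - artanh z \<le> 2 * (x - z)" by auto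
qed

section \<open>Euler factors at distance \<open>t\<close> from the critical line\<close>

definition pw :: "real \<Rightarrow> nat \<Rightarrow> real" where
  "pw t p = real p powr (-1/2 - t)"

lemma pw_pos: "2 \<le> p \<Longrightarrow> 0 < pw t p" by (simp add: pw_def)

lemma pw_mult: "pw t p * pw u p = real p powr (-1 - (t + u))"
  by (simp add: pw_def algebra_simps flip: powr_add)

lemma pw_sq: "(pw t p)\<^sup>2 = real p powr (-1 - 2*t)"
  using pw_mult[of t p t] by (simp add: power2_eq_square)

lemma pw_sq_le:
  assumes "2 \<le> p" "0 \<le> t"
  shows "(pw t p)\<^sup>2 \<le> 1/2" 
proof -
  have "real p powr (-1 - 2*t) \<le> real p powr (-1)" using assms by (intro powr_mono) auto
  also have "\<dots> \<le> 1/2" using assms by (simp add: powr_minus_divide)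
  finally show ?thesis by (simp add: pw_sq)
qed

lemma pw_le1:
  assumes "2 \<le> p" "0 \<le> t"
  shows "pw t p < 1"
proof (rule ccontr)
  assume "\<not> pw t p < 1"
  then have "1 \<le> (pw t p)\<^sup>2" by simp
  then show False using pw_sq_le[OF assms] by simp
qed

lemma pw_antimono:
  assumes "2 \<le> p" "t \<le> u"
  shows "pw u p \<le> pw t p"
  using assms unfolding pw_def by (intro powr_mono) auto

text \<open>The inequality \<open>1 - exp (-x) \<le> x\<close> brings in a factor
  \<open>ln p\<close>, and \<open>ln p \<le> 2 * p powr (1/2)\<close> is cancelled by
  \<open>pw 0 p\<close>. As the bound is uniform in \<open>p\<close> and linear in \<open>s\<close>,
  any fixed finite set of primes becomes negligible when \<open>s\<close> tends to 0.\<close>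

lemma pw_diff_le:
  assumes p: "2 \<le> p" and s: "0 \<le> s" and K: "1 \<le> K"
  shows "pw s p - pw (K * s) p \<le> 2 * K * s"
proof -
  have p0: "real p > 0" using p by simp
  have "pw (K * s) p = pw s p * exp (- ((K-1) * s * ln p))"
    using p by (simp add: pw_def powr_def algebra_simps flip: exp_add)
  then have "pw s p - pw (K * s) p = pw s p * (1 - exp (- ((K-1) * s * ln p)))" by (simp add: algebra_simps)
  also have "\<dots> \<le> pw s p * ((K-1) * s * ln p)"
    using exp_ge_add_one_self[of "- ((K-1) * s * ln p)"] pw_pos[OF p, of s] by (intro mult_left_mono) auto
  also have "\<dots> \<le> pw 0 p * (K * s * (2 * real p powr (1/2)))"
  proof (intro mult_mono)
    have "ln (real p powr (1/2)) \<le> real p powr (1/2)"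
      using p0 ln_le_minus_one[of "real p powr (1/2)"] by simp
    then show "ln (real p) \<le> 2 * real p powr (1/2)" using p0 by simp
  qed (use p s K pw_antimono[OF p, of 0 s] pw_pos[OF p, of 0] in auto)
  also have "\<dots> = 2 * K * s * (real p powr (-1/2) * real p powr (1/2))" by (simp add: pw_def)
  also have "real p powr (-1/2) * real p powr (1/2) = 1" using p0 by (simp flip: powr_add)
  finally show ?thesis by simp
qed

lemma sum_pw_sq: "(\<Sum>p\<in>primes_in 0 y. (pw t p)\<^sup>2) = prime_sum y (2*t)"
  by (simp add: pw_sq prime_sum_def)

text \<open>These sums control the logarithm of the ratio of Euler products at \<open>s\<close> and
  \<open>K * s\<close>: the first bounds the variance of its random part from below, the second
  bounds that variance and the deterministic part from above. \<open>K\<close> and \<open>V\<close>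
  are fixed before \<open>s\<close>, so the later bounds are uniform over all scales.\<close>

lemma separation_constants:
  obtains K V :: real where "1 < K" "0 < V"
    "\<And>s. 0 < s \<Longrightarrow> 2 * K * s \<le> 1 \<Longrightarrow> \<forall>\<^sub>F y in sequentially.
        1 \<le> (\<Sum>p\<in>primes_in 0 y. (pw s p - pw (K * s) p)\<^sup>2) \<and>
        (\<Sum>p\<in>primes_in 0 y. (pw s p)\<^sup>2 - (pw (K * s) p)\<^sup>2) \<le> V"
proof
  \<comment> \<open>The first sum is a second difference of \<open>prime_sum\<close>, hence at least \<open>ln (K / 4) - 12\<close>.\<close>
  define K :: real where "K = 4 * exp 13"
  have K1: "1 < K" unfolding K_def using exp_ge_add_one_self[of "13::real"] by linarith
  show "1 < K" by fact
  \<comment> \<open>The witness for \<open>V\<close>: the second sum is \<open>prime_sum\<close> at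
    \<open>2 * s\<close> minus \<open>prime_sum\<close> at \<open>2 * K * s\<close>, each known up
    to an error of 3.\<close>
  show "0 < ln K + 6" using K1 ln_gt_zero[of K] by linarith
  fix s :: real assume s: "0 < s" "2 * K * s \<le> 1"
  have Ks: "s < K * s" using K1 s by simp
  have s1: "2 * s \<le> 1" using s Ks by linarith
  have s2: "(K+1) * s \<le> 1" using Ks s by (simp only: distrib_right)
  have "\<forall>\<^sub>F y in sequentially. ln (1 / (2 * s)) - 3 \<le> prime_sum y (2 * s) \<and>
        ln (1 / (2*K * s)) - 3 \<le> prime_sum y (2*K * s)"
    by (intro eventually_conj prime_sum_ge) (use s s1 K1 in auto)
  then show "\<forall>\<^sub>F y in sequentially.
        1 \<le> (\<Sum>p\<in>primes_in 0 y. (pw s p - pw (K * s) p)\<^sup>2) \<and>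
        (\<Sum>p\<in>primes_in 0 y. (pw s p)\<^sup>2 - (pw (K * s) p)\<^sup>2) \<le> ln K + 6"
  proof eventually_elim
    case (elim y)
    have l: "ln (1 / (2 * s)) = - ln 2 - ln s" "ln (1 / (2*K * s)) = - ln 2 - ln K - ln s"
      "ln (1 / ((K+1) * s)) = - ln (K+1) - ln s"
      using s K1 by (auto simp: ln_div ln_mult)
    have "(\<Sum>p\<in>primes_in 0 y. (pw s p - pw (K * s) p)\<^sup>2) =
       (\<Sum>p\<in>primes_in 0 y. (pw s p)\<^sup>2 + (pw (K * s) p)\<^sup>2 - 2 * (pw s p * pw (K * s) p))"
      by (simp add: power2_diff algebra_simps)
    also have "\<dots> = prime_sum y (2 * s) + prime_sum y (2*K * s) - 2 * prime_sum y ((K+1) * s)"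
      by (simp add: sum.distrib sum_subtractf sum_distrib_left[symmetric] sum_pw_sq)
         (simp add: pw_mult prime_sum_def algebra_simps)
    finally have eq: "(\<Sum>p\<in>primes_in 0 y. (pw s p - pw (K * s) p)\<^sup>2) =
        prime_sum y (2 * s) + prime_sum y (2*K * s) - 2 * prime_sum y ((K+1) * s)" .
    have up: "prime_sum y ((K+1) * s) \<le> ln (1 / ((K+1) * s)) + 3"
      using s s2 K1 by (intro prime_sum_le) auto
    have "ln K \<le> ln (K+1)" using K1 by simp
    moreover have "ln K = ln 4 + 13" unfolding K_def by (simp add: ln_mult)
    moreover have "ln (4::real) = ln 2 + ln 2" using ln_mult_pos[of 2 "2::real"] by simp
    ultimately have 1: "1 \<le> (\<Sum>p\<in>primes_in 0 y. (pw s p - pw (K * s) p)\<^sup>2)"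
      unfolding eq using up elim l by linarith
    have "(\<Sum>p\<in>primes_in 0 y. (pw s p)\<^sup>2 - (pw (K * s) p)\<^sup>2) = prime_sum y (2 * s) - prime_sum y (2*K * s)"
      by (simp add: sum_subtractf sum_pw_sq mult.assoc)
    also have "\<dots> \<le> ln K + 6"
      using prime_sum_le[of "2 * s" y] s s1 elim l by auto
    finally show ?case using 1 by simp
  qed
qed

section \<open>Partial summation and monotonicity of its weights\<close>

definition step_weight :: "real \<Rightarrow> nat \<Rightarrow> real" where
  "step_weight t n = real n powr (-t) - real (Suc n) powr (-t)"

text \<open>The quotient \<open>step_weight t n / t\<close> is the integral of
  \<open>x powr (-1-t)\<close> over \<open>[n, n+1]\<close>, hence decreasing in \<open>t\<close>.
  The difference of the two integrands is at most \<open>u - t\<close>, because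
  \<open>ln z \<le> z\<close>.\<close>

lemma step_weight_compare:
  assumes "0 < t" "t \<le> u" "1 \<le> n"
  shows "0 \<le> step_weight t n - t / u * step_weight u n"
    and "step_weight t n - t / u * step_weight u n \<le> t * (u - t)"
proof -
  \<comment> \<open>One function holds both antiderivatives, so that a single intermediate point
    \<open>z\<close> serves both exponents.\<close>
  let ?h = "\<lambda>x. x powr (-u) / u - x powr (-t) / t"
  have "\<exists>z. real n < z \<and> z < real n + 1 \<and>
      ?h (real n + 1) - ?h (real n) = (real n + 1 - real n) * (z powr (-1-t) - z powr (-1-u))"
    using assms by (intro MVT2) (auto intro!: derivative_eq_intros simp: field_simps minus_diff_commute)
  then obtain z where z: "real n < z" 
    "?h (real n + 1) - ?h (real n) = z powr (-1-t) - z powr (-1-u)" by auto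
  have z1: "1 < z" using z(1) assms by simp
  have "step_weight t n - t / u * step_weight u n = t * (?h (real n + 1) - ?h (real n))"
    using assms by (simp add: step_weight_def field_simps)
  then have eq: "step_weight t n - t / u * step_weight u n = t * (z powr (-1-t) - z powr (-1-u))"
    using z(2) by simp
  have "z powr (-1-u) \<le> z powr (-1-t)" using z1 assms by (intro powr_mono) auto
  then show "0 \<le> step_weight t n - t / u * step_weight u n" unfolding eq using assms by simp
  have "z powr (-1-t) - z powr (-1-u) = z powr (-1-t) * (1 - z powr (-(u - t)))"
    by (simp add: algebra_simps flip: powr_add)
  also have "\<dots> \<le> z powr (-1-t) * ((u - t) * ln z)"
    using exp_ge_add_one_self[of "- ((u - t) * ln z)"] z1
    by (intro mult_left_mono) (auto simp: powr_def algebra_simps)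
  also have "\<dots> \<le> z powr (-1) * ((u - t) * z)"
    using z1 assms ln_le_minus_one[of z] by (intro mult_mono powr_mono) auto
  also have "\<dots> = u - t" using z1 by (simp add: powr_minus_divide)
  finally show "step_weight t n - t / u * step_weight u n \<le> t * (u - t)"
    unfolding eq using assms by (intro mult_left_mono) auto
qed

text \<open>The boundary term of the summation by parts stays inside the coefficients, where it is
  later estimated in mean square.\<close>

lemma abel_summation:
  fixes a :: "nat \<Rightarrow> real"
  shows "(\<Sum>n=1..N. (\<Sum>m=1..n. a m) * step_weight t n) =
    (\<Sum>m=1..N. a m * (real m powr (-t) - real (Suc N) powr (-t)))"
proof (induction N)
  case (Suc N)
  have "(\<Sum>m=1..N. a m * (real m powr (-t) - real (Suc (Suc N)) powr (-t))) =
    (\<Sum>m=1..N. a m * (real m powr (-t) - real (Suc N) powr (-t)) + a m * step_weight t (Suc N))"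
    by (simp add: step_weight_def algebra_simps)
  also have "\<dots> = (\<Sum>m=1..N. a m * (real m powr (-t) - real (Suc N) powr (-t))) + (\<Sum>m=1..N. a m) * step_weight t (Suc N)"
    by (simp only: sum.distrib sum_distrib_right)
  finally show ?case using Suc by (simp add: step_weight_def algebra_simps)
qed simp

text \<open>From \<open>n0\<close> on, the weight differences and the \<open>a n\<close> are
  nonnegative. An earlier index costs at most \<open>(u - t) * \<bar>a n\<bar>\<close>, where
  \<open>t \<le> 1\<close> absorbs a factor. The total error is independent of \<open>N\<close> and
  linear in \<open>u - t\<close>.\<close>

lemma step_weight_sum_compare:
  assumes t: "0 < t" "t \<le> u" "t \<le> 1" and a: "\<And>n. n0 \<le> n \<Longrightarrow> 0 \<le> a n"
  shows "t / u * (\<Sum>n=1..N. a n * step_weight u n) - (u - t) * (\<Sum>n=1..n0. \<bar>a n\<bar>)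
    \<le> (\<Sum>n=1..N. a n * step_weight t n)"
proof -
  let ?d = "\<lambda>n. step_weight t n - t / u * step_weight u n"
  have d: "0 \<le> ?d n \<and> ?d n \<le> u - t" if "1 \<le> n" for n
    using step_weight_compare[OF t(1,2) that] t mult_right_mono[of t 1 "u - t"] by auto
  have "- ((u - t) * (\<Sum>n=1..n0. \<bar>a n\<bar>)) = - (\<Sum>n\<in>{1..n0}. (u - t) * \<bar>a n\<bar>)"
    by (simp add: sum_distrib_left)
  \<comment> \<open>\<open>N\<close> may lie below \<open>n0\<close>, hence the
    intersection.\<close>
  also have "\<dots> \<le> - (\<Sum>n\<in>{1..N} \<inter> {1..n0}. (u - t) * \<bar>a n\<bar>)"
    unfolding neg_le_iff_le using t by (intro sum_mono2) auto
  also have "\<dots> = (\<Sum>n=1..N. if n \<in> {1..n0} then - ((u - t) * \<bar>a n\<bar>) else 0)"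
    by (subst sum.inter_restrict[symmetric]) (simp_all add: sum_negf)
  also have "\<dots> \<le> (\<Sum>n=1..N. a n * ?d n)"
  proof (rule sum_mono)
    fix n assume n: "n \<in> {1..N}"
    show "(if n \<in> {1..n0} then - ((u - t) * \<bar>a n\<bar>) else 0) \<le> a n * ?d n"
    proof (cases "n \<in> {1..n0}")
      case True
      have "\<bar>a n * ?d n\<bar> \<le> \<bar>a n\<bar> * (u - t)"
        using d[of n] n by (subst abs_mult, intro mult_left_mono) auto
      then have "- (\<bar>a n\<bar> * (u - t)) \<le> a n * ?d n" by (meson abs_le_D2 minus_le_iff)
      then show ?thesis using True by (simp only: mult.commute if_True)
    next
      case False
      then show ?thesis using a[of n] d[of n] n by (auto intro: mult_nonneg_nonneg)
    qed
  qed
  also have "\<dots> = (\<Sum>n=1..N. a n * step_weight t n) - t / u * (\<Sum>n=1..N. a n * step_weight u n)"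
    by (simp add: right_diff_distrib sum_subtractf sum_distrib_left mult_ac)
  finally show ?thesis by linarith
qed

section \<open>Gaussian bounds for the hyperbolic cosine\<close>

lemma cosh_ge_exp:
  fixes x :: real
  assumes "\<bar>x\<bar> \<le> 1"
  shows "exp (x\<^sup>2 / 4) \<le> cosh x"
proof -
  have x2: "x\<^sup>2 \<le> 1" using assms by (simp add: abs_square_le_1)
  have "exp (x\<^sup>2/4) \<le> 1 + x\<^sup>2/4 + (x\<^sup>2/4)\<^sup>2" using x2 by (intro exp_bound) auto
  also have "(x\<^sup>2/4)\<^sup>2 \<le> x\<^sup>2/4" using x2 by (subst power2_eq_square) (rule mult_left_le, auto)
  finally have "exp (x\<^sup>2/4) \<le> 1 + x\<^sup>2/2" by simp
  also have "1 + x\<^sup>2/2 = (\<Sum>n<3. if even n then x ^ n /\<^sub>R fact n else 0)"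
    by (simp add: eval_nat_numeral)
  also have "\<dots> \<le> (\<Sum>n. if even n then x ^ n /\<^sub>R fact n else 0)"
    using cosh_converges[of x] by (intro sum_le_suminf) (auto simp: sums_iff zero_le_even_power)
  also have "\<dots> = cosh x" using cosh_converges[of x] by (simp add: sums_iff)
  finally show ?thesis .
qed

lemma cosh_le_exp:
  fixes x :: real
  assumes "\<bar>x\<bar> \<le> 1"
  shows "cosh x \<le> exp (x\<^sup>2)"
proof -
  have *: "cosh y \<le> 1 + y\<^sup>2" if y: "0 \<le> y" "y \<le> 1" for y :: real
  proof -
    \<comment> \<open>Bounding \<open>exp (-y)\<close> by \<open>1 - y + y^2\<close> and
      \<open>exp y\<close> by \<open>1 + y + y^2\<close> lets the linear terms cancel in the
      mean.\<close>
    have "exp (-y) \<le> 1 / (1 + y)"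
      using exp_ge_add_one_self[of y] y by (simp add: exp_minus field_simps)
    also have "\<dots> \<le> 1 - y + y\<^sup>2"
      using y by (simp add: field_simps power2_eq_square)
    finally show ?thesis using exp_bound[of y] y by (simp add: cosh_def)
  qed
  have "cosh x = cosh \<bar>x\<bar>" by (simp add: abs_if)
  also have "\<dots> \<le> 1 + x\<^sup>2" using *[of "\<bar>x\<bar>"] assms by simp
  also have "\<dots> \<le> exp (x\<^sup>2)" by (rule exp_ge_add_one_self)
  finally show ?thesis .
qed

section \<open>Random Euler products\<close>

text \<open>The values are signs at every sample point, so that identities and bounds for Euler
  products hold pointwise and not just almost surely.\<close>

locale random_signs = prob_space M for M :: "'a measure" +
  fixes e :: "nat \<Rightarrow> 'a \<Rightarrow> real"
  assumes indep: "indep_vars (\<lambda>_. borel) e {p. prime p}"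
    and sign: "e p \<omega> = 1 \<or> e p \<omega> = -1"
    and mean_zero: "prime p \<Longrightarrow> expectation (e p) = 0"
begin

lemma borel_measurable_e [measurable]: "prime p \<Longrightarrow> e p \<in> borel_measurable M"
  using indep by (auto simp: indep_vars_def)

lemma
  fixes g :: "nat \<Rightarrow> real \<Rightarrow> real"
  assumes B: "finite B" "\<And>p. p \<in> B \<Longrightarrow> prime p"
  shows expectation_prod_e: "expectation (\<lambda>\<omega>. \<Prod>p\<in>B. g p (e p \<omega>)) = (\<Prod>p\<in>B. (g p 1 + g p (-1)) / 2)"
    and integrable_prod_e: "integrable M (\<lambda>\<omega>. \<Prod>p\<in>B. g p (e p \<omega>))"
proof -
  \<comment> \<open>On the two values of a sign, every function agrees with this affine
    interpolation. So mean zero determines the expectation, and \<open>h p\<close> is measurable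
    whatever \<open>g p\<close> is.\<close>
  define h where "h p x = (g p 1 + g p (-1)) / 2 + (g p 1 - g p (-1)) / 2 * x" for p x
  have h: "g p (e p \<omega>) = h p (e p \<omega>)" for p \<omega>
    using sign[of p \<omega>] by (auto simp: h_def field_simps)
  have int_e: "integrable M (e p)" if "prime p" for p
  proof (rule integrable_const_bound[of _ 1])
    show "AE \<omega> in M. norm (e p \<omega>) \<le> 1"
    proof (rule AE_I2)
      fix \<omega> show "norm (e p \<omega>) \<le> 1" using sign[of p \<omega>] by auto
    qed
  qed (use that in measurable)
  have int: "integrable M (\<lambda>\<omega>. h p (e p \<omega>))" if "p \<in> B" for p
    using int_e[OF B(2)[OF that]] by (simp add: h_def)
  have "indep_vars (\<lambda>_. borel) e B" using indep_vars_subset[OF indep] B by auto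
  then have ind: "indep_vars (\<lambda>_. borel) (\<lambda>p \<omega>. h p (e p \<omega>)) B"
    by (rule indep_vars_compose2) (simp add: h_def)
  show "integrable M (\<lambda>\<omega>. \<Prod>p\<in>B. g p (e p \<omega>))"
    unfolding h by (rule indep_vars_integrable[OF B(1) ind int])
  have "expectation (\<lambda>\<omega>. h p (e p \<omega>)) = (g p 1 + g p (-1)) / 2" if "p \<in> B" for p
    using int_e[OF B(2)[OF that]] mean_zero[OF B(2)[OF that]] by (simp add: h_def prob_space)
  then show "expectation (\<lambda>\<omega>. \<Prod>p\<in>B. g p (e p \<omega>)) = (\<Prod>p\<in>B. (g p 1 + g p (-1)) / 2)"
    unfolding h by (subst indep_vars_lebesgue_integral[OF B(1) ind int]) (auto intro!: prod.cong)
qed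

section \<open>Orthogonality of the random multiplicative function\<close>

definition chi :: "nat \<Rightarrow> 'a \<Rightarrow> real" where
  "chi n \<omega> = (\<Prod>p\<in>prime_factors n. e p \<omega>)"

text \<open>Distinct squarefree numbers differ in some prime factor, whose sign then occurs exactly
  once in the product and contributes mean 0. For \<open>m = n\<close> every sign occurs
  squared.\<close>

lemma chi_orthogonal:
  assumes "squarefree m" "squarefree n"
  shows "expectation (\<lambda>\<omega>. chi m \<omega> * chi n \<omega>) = (if m = n then 1 else 0)"
    and "integrable M (\<lambda>\<omega>. chi m \<omega> * chi n \<omega>)"
proof -
  define B where "B = prime_factors m \<union> prime_factors n"
  define g :: "nat \<Rightarrow> real \<Rightarrow> real" where
    "g p x = (if p \<in> prime_factors m then x else 1) * (if p \<in> prime_factors n then x else 1)" for p x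
  have B: "finite B" "\<And>p. p \<in> B \<Longrightarrow> prime p" by (auto simp: B_def)
  have Bm: "B \<inter> prime_factors m = prime_factors m" "B \<inter> prime_factors n = prime_factors n"
    by (auto simp: B_def)
  have eq: "chi m \<omega> * chi n \<omega> = (\<Prod>p\<in>B. g p (e p \<omega>))" for \<omega>
  proof -
    have "(\<Prod>p\<in>B. g p (e p \<omega>)) = (\<Prod>p\<in>B. if p \<in> prime_factors m then e p \<omega> else 1) *
        (\<Prod>p\<in>B. if p \<in> prime_factors n then e p \<omega> else 1)"
      by (simp only: g_def prod.distrib)
    also have "\<dots> = chi m \<omega> * chi n \<omega>"
      using B(1) by (simp only: prod.inter_restrict[symmetric] Bm chi_def)
    finally show ?thesis by simp
  qed
  show "integrable M (\<lambda>\<omega>. chi m \<omega> * chi n \<omega>)"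
    unfolding eq using B by (rule integrable_prod_e)
  have "expectation (\<lambda>\<omega>. chi m \<omega> * chi n \<omega>) = (\<Prod>p\<in>B. (g p 1 + g p (-1)) / 2)"
    unfolding eq using B by (rule expectation_prod_e)
  also have "\<dots> = (if m = n then 1 else 0)"
  proof (cases "m = n")
    case True
    then show ?thesis by (auto simp: g_def B_def intro!: prod.neutral)
  next
    case False
    then have "prime_factors m \<noteq> prime_factors n"
      using prod_prime_factors_squarefree assms by metis
    then obtain p where "p \<in> B" "(p \<in> prime_factors m) \<noteq> (p \<in> prime_factors n)"
      by (auto simp: B_def)
    then have "(g p 1 + g p (-1)) / 2 = 0" by (auto simp: g_def)
    then show ?thesis using False \<open>p \<in> B\<close> B(1) by (auto intro!: prod_zero)
  qed
  finally show "expectation (\<lambda>\<omega>. chi m \<omega> * chi n \<omega>) = (if m = n then 1 else 0)" .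
qed

lemma
  assumes I: "finite I" "\<And>n. n \<in> I \<Longrightarrow> squarefree n"
  shows expectation_sum_chi_sq: "expectation (\<lambda>\<omega>. (\<Sum>n\<in>I. c n * chi n \<omega>)\<^sup>2) = (\<Sum>n\<in>I. (c n)\<^sup>2)"
    and integrable_sum_chi_sq: "integrable M (\<lambda>\<omega>. (\<Sum>n\<in>I. c n * chi n \<omega>)\<^sup>2)"
proof -
  have eq: "(\<Sum>n\<in>I. c n * chi n \<omega>)\<^sup>2 = (\<Sum>m\<in>I. \<Sum>n\<in>I. c m * c n * (chi m \<omega> * chi n \<omega>))" for \<omega>
    by (simp add: power2_eq_square sum_product mult_ac)
  have int: "integrable M (\<lambda>\<omega>. c m * c n * (chi m \<omega> * chi n \<omega>))" if "m \<in> I" "n \<in> I" for m n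
    using chi_orthogonal(2)[OF I(2)[OF that(1)] I(2)[OF that(2)]] by simp
  show "integrable M (\<lambda>\<omega>. (\<Sum>n\<in>I. c n * chi n \<omega>)\<^sup>2)"
    unfolding eq by (intro Bochner_Integration.integrable_sum int)
  have "expectation (\<lambda>\<omega>. (\<Sum>n\<in>I. c n * chi n \<omega>)\<^sup>2) = 
      (\<Sum>m\<in>I. \<Sum>n\<in>I. c m * c n * expectation (\<lambda>\<omega>. chi m \<omega> * chi n \<omega>))"
    unfolding eq using int
    by (subst Bochner_Integration.integral_sum, intro Bochner_Integration.integrable_sum, simp)
       (intro sum.cong refl, subst Bochner_Integration.integral_sum, auto)
  also have "\<dots> = (\<Sum>m\<in>I. \<Sum>n\<in>I. if m = n then (c m)\<^sup>2 else 0)"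
    by (intro sum.cong refl) (simp add: chi_orthogonal I power2_eq_square)
  also have "\<dots> = (\<Sum>n\<in>I. (c n)\<^sup>2)" using I(1) by simp
  finally show "expectation (\<lambda>\<omega>. (\<Sum>n\<in>I. c n * chi n \<omega>)\<^sup>2) = (\<Sum>n\<in>I. (c n)\<^sup>2)" .
qed

lemma borel_measurable_chi [measurable]: "chi n \<in> borel_measurable M"
  unfolding chi_def[abs_def] by (intro borel_measurable_prod borel_measurable_e) auto

lemma random_mult_eq_chi: "random_mult e n \<omega> = (if squarefree n then chi n \<omega> else 0)"
  by (simp add: random_mult_def moebius_mu_def chi_def flip: power_mult)

section \<open>Truncated random Euler products\<close>

definition euler :: "real \<Rightarrow> nat \<Rightarrow> nat \<Rightarrow> 'a \<Rightarrow> real" where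
  "euler t a y \<omega> = (\<Prod>p\<in>primes_in a y. 1 + e p \<omega> * pw t p)"

lemma borel_measurable_euler [measurable]: "euler t a y \<in> borel_measurable M"
  unfolding euler_def[abs_def] 
  by (intro borel_measurable_prod borel_measurable_add borel_measurable_times borel_measurable_e borel_measurable_const)
     (auto simp: primes_inD)

lemma euler_factor_pos:
  assumes "p \<in> primes_in a y" "0 \<le> t"
  shows "0 < 1 + e p \<omega> * pw t p" "1 - pw t p \<le> 1 + e p \<omega> * pw t p" "0 < 1 - pw t p"
  using sign[of p \<omega>] pw_le1[of p t] pw_pos[of p t] primes_in_ge_2[OF assms(1)] assms(2) by auto

lemma euler_eq_sum:
  "euler t 0 y \<omega> = (\<Sum>n\<in>sqf (primes_in 0 y). real n powr (-1/2 - t) * chi n \<omega>)"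
  unfolding euler_def
  by (subst prod_one_plus_eq_sum_sqf)
     (auto simp: primes_inD sqf_def prod.distrib pw_def prod_prime_factors_powr chi_def intro!: sum.cong)

lemma euler_split:
  "a \<le> b \<Longrightarrow> b \<le> c \<Longrightarrow> euler t a c \<omega> = euler t a b \<omega> * euler t b c \<omega>"
  unfolding euler_def primes_in_split(1)[of a b c]
  by (rule prod.union_disjoint) (auto simp: primes_in_split(2)[of a b c])

text \<open>The factors are independent with mean 1 and second moment \<open>1 + (pw t p)^2\<close>.
  The purpose is that extending an Euler product beyond a large prime bound multiplies it by
  something close to 1.\<close>

lemma expectation_euler_minus_one_sq:
  assumes t: "0 < t" and a: "0 < a"
  shows "integrable M (\<lambda>\<omega>. (euler t a y \<omega> - 1)\<^sup>2)"
    and "expectation (\<lambda>\<omega>. (euler t a y \<omega> - 1)\<^sup>2) \<le> exp (real a powr (-2*t) / (2*t)) - 1"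
proof -
  have eq: "(euler t a y \<omega> - 1)\<^sup>2 = (\<Prod>p\<in>primes_in a y. (1 + e p \<omega> * pw t p)\<^sup>2) - 2 * (\<Prod>p\<in>primes_in a y. 1 + e p \<omega> * pw t p) + 1" for \<omega>
    by (simp add: euler_def power2_diff prod_power_distrib)
  have B: "finite (primes_in a y)" "\<And>p. p \<in> primes_in a y \<Longrightarrow> prime p" by (auto simp: primes_inD)
  have int: "integrable M (\<lambda>\<omega>. \<Prod>p\<in>primes_in a y. (1 + e p \<omega> * pw t p)\<^sup>2)"
            "integrable M (\<lambda>\<omega>. \<Prod>p\<in>primes_in a y. 1 + e p \<omega> * pw t p)"
    using integrable_prod_e[OF B, of "\<lambda>p x. (1 + x * pw t p)\<^sup>2"] integrable_prod_e[OF B, of "\<lambda>p x. 1 + x * pw t p"]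
    by auto
  show "integrable M (\<lambda>\<omega>. (euler t a y \<omega> - 1)\<^sup>2)" unfolding eq using int by simp
  have "expectation (\<lambda>\<omega>. (euler t a y \<omega> - 1)\<^sup>2) = (\<Prod>p\<in>primes_in a y. 1 + (pw t p)\<^sup>2) - 1"
  proof -
    have "expectation (\<lambda>\<omega>. (euler t a y \<omega> - 1)\<^sup>2) = 
        expectation (\<lambda>\<omega>. \<Prod>p\<in>primes_in a y. (1 + e p \<omega> * pw t p)\<^sup>2)
        - 2 * expectation (\<lambda>\<omega>. \<Prod>p\<in>primes_in a y. 1 + e p \<omega> * pw t p) + 1"
      unfolding eq using int by (simp add: prob_space)
    also have "expectation (\<lambda>\<omega>. \<Prod>p\<in>primes_in a y. 1 + e p \<omega> * pw t p) = 1"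
      by (subst expectation_prod_e[OF B, of "\<lambda>p x. 1 + x * pw t p"]) auto
    also have "expectation (\<lambda>\<omega>. \<Prod>p\<in>primes_in a y. (1 + e p \<omega> * pw t p)\<^sup>2) = (\<Prod>p\<in>primes_in a y. 1 + (pw t p)\<^sup>2)"
      by (subst expectation_prod_e[OF B, of "\<lambda>p x. (1 + x * pw t p)\<^sup>2"])
         (auto simp: power2_eq_square field_simps intro!: prod.cong)
    finally show ?thesis by simp
  qed
  also have "(\<Prod>p\<in>primes_in a y. 1 + (pw t p)\<^sup>2) \<le> (\<Prod>p\<in>primes_in a y. exp ((pw t p)\<^sup>2))"
    by (intro prod_mono) (auto intro: exp_ge_add_one_self add_nonneg_nonneg)
  also have "\<dots> = exp (\<Sum>p\<in>primes_in a y. real p powr (-1 - 2 * t))" by (simp add: exp_sum pw_sq)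
  also have "(\<Sum>p\<in>primes_in a y. real p powr (-1 - 2 * t)) \<le> real a powr (-(2*t)) / (2*t)"
    using t a by (intro sum_powr_tail_le) (auto simp: primes_inD)
  finally show "expectation (\<lambda>\<omega>. (euler t a y \<omega> - 1)\<^sup>2) \<le> exp (real a powr (-2*t) / (2*t)) - 1" by simp
qed

text \<open>The exponent is such that \<open>m powr (-\<alpha>)\<close> times
  \<open>m powr (-(1/2 - \<alpha> + t))\<close> equals \<open>m powr (-1/2 - t)\<close>: for every
  \<open>\<alpha>\<close>, partial summation relates this sum to the Euler product at
  \<open>1/2 + t\<close>.\<close>

definition smoothed :: "real \<Rightarrow> nat \<Rightarrow> real \<Rightarrow> 'a \<Rightarrow> real" where
  "smoothed \<alpha> N t \<omega> = (\<Sum>n=1..N. (\<Sum>m=1..n. random_mult e m \<omega> / real m powr \<alpha>) * step_weight (1/2 - \<alpha> + t) n)"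

lemma borel_measurable_random_mult [measurable]: "random_mult e n \<in> borel_measurable M"
  unfolding random_mult_eq_chi[abs_def] by measurable

lemma borel_measurable_smoothed [measurable]: "smoothed \<alpha> N t \<in> borel_measurable M"
  unfolding smoothed_def[abs_def] by measurable

text \<open>Both quantities are linear combinations of the orthonormal functions
  \<open>chi n\<close>, so the mean square is the sum of the squared differences of
  coefficients.\<close>

lemma smoothed_minus_euler:
  assumes t: "0 < t" and \<alpha>: "\<alpha> \<le> 1/2" and N: "0 < N"
  shows "integrable M (\<lambda>\<omega>. (smoothed \<alpha> N t \<omega> - euler t 0 N \<omega>)\<^sup>2)"
    and "expectation (\<lambda>\<omega>. (smoothed \<alpha> N t \<omega> - euler t 0 N \<omega>)\<^sup>2) \<le> 2 * (1 + 1/t) * real N powr (-t)"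
proof -
  define s where "s = 1/2 - \<alpha> + t"
  define S where "S = sqf (primes_in 0 N)"
  define Q where "Q = {n. squarefree n \<and> n \<le> N}"
  have QS: "Q \<subseteq> S" "finite S" "finite Q" "0 \<notin> S" "0 \<notin> Q"
    using sqf_le_subset[of N] finite_subset[of Q S] by (auto simp: Q_def S_def zero_notin_sqf)
  \<comment> \<open>For squarefree \<open>n \<le> N\<close> only the boundary term of the partial
    summation survives; the larger \<open>n\<close> in \<open>S\<close> occur in the Euler product
    alone.\<close>
  define c where "c n = (if n \<in> Q then - (real n powr (-\<alpha>) * real (Suc N) powr (-s)) else - (real n powr (-1/2-t)))" for n
  have eq: "smoothed \<alpha> N t \<omega> - euler t 0 N \<omega> = (\<Sum>n\<in>S. c n * chi n \<omega>)" for \<omega>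
  proof -
    have "smoothed \<alpha> N t \<omega> = (\<Sum>m=1..N. random_mult e m \<omega> / real m powr \<alpha> * (real m powr (-s) - real (Suc N) powr (-s)))"
      unfolding smoothed_def s_def[symmetric] by (rule abel_summation)
    also have "\<dots> = (\<Sum>m\<in>Q. random_mult e m \<omega> / real m powr \<alpha> * (real m powr (-s) - real (Suc N) powr (-s)))"
      using QS(5) by (intro sum.mono_neutral_right) (auto simp: Q_def random_mult_eq_chi intro!: Suc_leI gr0I)
    also have "\<dots> = (\<Sum>m\<in>Q. (real m powr (-1/2-t) - real m powr (-\<alpha>) * real (Suc N) powr (-s)) * chi m \<omega>)"
    proof (intro sum.cong refl)
      fix m assume m: "m \<in> Q"
      have "real m powr (-1/2-t) = real m powr (-\<alpha>) * real m powr (-s)"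
        by (simp add: s_def flip: powr_add)
      moreover have "random_mult e m \<omega> / real m powr \<alpha> = real m powr (-\<alpha>) * chi m \<omega>"
        using m by (simp add: random_mult_eq_chi Q_def powr_minus_divide)
      ultimately show "random_mult e m \<omega> / real m powr \<alpha> * (real m powr (-s) - real (Suc N) powr (-s)) =
         (real m powr (-1/2-t) - real m powr (-\<alpha>) * real (Suc N) powr (-s)) * chi m \<omega>"
        by (simp only: algebra_simps)
    qed
    also have "\<dots> = (\<Sum>m\<in>S. (if m \<in> Q then (real m powr (-1/2-t) - real m powr (-\<alpha>) * real (Suc N) powr (-s)) * chi m \<omega> else 0))"
      using QS by (subst sum.inter_restrict[symmetric]) (auto simp: Int_absorb1)
    finally have "smoothed \<alpha> N t \<omega> - euler t 0 N \<omega> = 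
       (\<Sum>m\<in>S. (if m \<in> Q then (real m powr (-1/2-t) - real m powr (-\<alpha>) * real (Suc N) powr (-s)) * chi m \<omega> else 0)
          - real m powr (-1/2 - t) * chi m \<omega>)"
      by (simp only: euler_eq_sum S_def[symmetric] sum_subtractf)
    also have "\<dots> = (\<Sum>n\<in>S. c n * chi n \<omega>)"
      by (intro sum.cong refl) (auto simp: c_def algebra_simps)
    finally show ?thesis .
  qed
  have sq: "\<And>n. n \<in> S \<Longrightarrow> squarefree n" by (auto simp: S_def sqf_def)
  show "integrable M (\<lambda>\<omega>. (smoothed \<alpha> N t \<omega> - euler t 0 N \<omega>)\<^sup>2)"
    unfolding eq using QS(2) sq by (rule integrable_sum_chi_sq)
  have "expectation (\<lambda>\<omega>. (smoothed \<alpha> N t \<omega> - euler t 0 N \<omega>)\<^sup>2) = (\<Sum>n\<in>S. (c n)\<^sup>2)"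
    unfolding eq using QS(2) sq by (rule expectation_sum_chi_sq)
  also have "\<dots> = (\<Sum>n\<in>Q. (c n)\<^sup>2) + (\<Sum>n\<in>S-Q. (c n)\<^sup>2)"
    using QS by (simp add: sum.subset_diff[of Q S] add.commute)
  also have "(\<Sum>n\<in>Q. (c n)\<^sup>2) \<le> (\<Sum>n\<in>Q. real n powr (-1-t) * real N powr (-t))"
  proof (rule sum_mono)
    fix n assume n: "n \<in> Q"
    then have n0: "0 < n" "n \<le> N" using QS(5) by (auto simp: Q_def intro!: gr0I)
    have "(c n)\<^sup>2 = real n powr (-2*\<alpha>) * real (Suc N) powr (-2 * s)"
      using n by (simp add: c_def power2_eq_square mult_ac powr_add[symmetric])
    \<comment> \<open>The exponent \<open>2 * s - t = 1 - 2 * \<alpha> + t\<close> is nonnegative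
      since \<open>\<alpha> \<le> 1/2\<close>, so \<open>n\<close> may be replaced by
      \<open>N\<close> there, while a summable power of \<open>n\<close> remains.\<close>
    also have "real n powr (-2*\<alpha>) = real n powr (-1-t) * real n powr (2 * s - t)"
      by (simp add: s_def flip: powr_add)
    also have "\<dots> * real (Suc N) powr (-2 * s) \<le> real n powr (-1-t) * real N powr (2 * s-t) * real N powr (-2 * s)"
      using n0 t \<alpha> by (intro mult_mono powr_mono2 powr_mono2') (auto simp: s_def)
    also have "\<dots> = real n powr (-1-t) * real N powr (-t)" by (simp flip: powr_add)
    finally show "(c n)\<^sup>2 \<le> real n powr (-1-t) * real N powr (-t)" .
  qed
  also have "\<dots> = (\<Sum>n\<in>Q. real n powr (-1-t)) * real N powr (-t)" by (simp add: sum_distrib_right)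
  also have "\<dots> \<le> (1 + 1/t) * real N powr (-t)"
    using QS t by (intro mult_right_mono sum_powr_le) auto
  also have "(\<Sum>n\<in>S-Q. (c n)\<^sup>2) = (\<Sum>n\<in>S-Q. real n powr (-1 - 2*t))"
    by (intro sum.cong) (auto simp: c_def power2_eq_square simp flip: powr_add)
  also have "\<dots> \<le> real N powr (-(2*t)) / (2*t)"
    using t N QS sq by (intro sum_powr_tail_le) (auto simp: Q_def not_le)
  also have "\<dots> \<le> real N powr (-t) / t"
    using t N by (intro frac_le powr_mono) auto
  also have "\<dots> \<le> (1 + 1/t) * real N powr (-t)" using t by (simp add: field_simps)
  finally show "expectation (\<lambda>\<omega>. (smoothed \<alpha> N t \<omega> - euler t 0 N \<omega>)\<^sup>2) \<le> 2 * (1 + 1/t) * real N powr (-t)"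
    by (simp only: mult_2 distrib_right)
qed

text \<open>The smoothed sum is close to the Euler product up to \<open>N\<close>, which is the
  product up to \<open>y\<close> times a factor close to 1. The cut \<open>y\<close> is fixed before
  \<open>N\<close>, because turning the absolute error of the first step into a relative one takes a
  lower bound that depends on \<open>y\<close>.\<close>

lemma prob_smoothed_approx:
  assumes t: "0 < t" and \<alpha>: "\<alpha> \<le> 1/2" and \<epsilon>: "0 < \<epsilon>"
  shows "\<forall>\<^sub>F y in sequentially. \<forall>\<^sub>F N in sequentially.
    prob {\<omega>\<in>space M. \<not> (euler t 0 y \<omega> / 2 \<le> smoothed \<alpha> N t \<omega> \<and> smoothed \<alpha> N t \<omega> \<le> 2 * euler t 0 y \<omega>)} \<le> \<epsilon>"
proof -
  have "(\<lambda>y. 16 * (exp (real y powr (-(2*t)) / (2*t)) - 1)) \<longlonglongrightarrow> 16 * (exp (0 / (2*t)) - 1)"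
    using t by (intro tendsto_intros tendsto_nat_powr_neg) auto
  then have "\<forall>\<^sub>F y in sequentially. 16 * (exp (real y powr (-(2*t)) / (2*t)) - 1) < \<epsilon> / 2"
    by (rule order_tendstoD) (use \<epsilon> in simp)
  moreover have "\<forall>\<^sub>F y in sequentially. (0::nat) < y" by (rule eventually_gt_at_top)
  ultimately show ?thesis
  proof eventually_elim
    case (elim y)
    \<comment> \<open>The value of the Euler product when all signs are -1, a deterministic lower
      bound. With tolerances \<open>1/4\<close> and \<open>c/4\<close> the two errors add up to at
      most half the product.\<close>
    define c where "c = (\<Prod>p\<in>primes_in 0 y. 1 - pw t p)"
    have c0: "0 < c" unfolding c_def using t by (intro prod_pos euler_factor_pos) auto
    have cle: "c \<le> euler t 0 y \<omega>" for \<omega>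
      unfolding c_def euler_def using t euler_factor_pos[of _ 0 y t] by (intro prod_mono) (force intro: less_imp_le)
    have "(\<lambda>N. 2 * (1 + 1/t) * real N powr (-t) / (c/4)\<^sup>2) \<longlonglongrightarrow> 2 * (1 + 1/t) * 0 / (c/4)\<^sup>2"
      using t c0 by (intro tendsto_intros tendsto_nat_powr_neg) auto
    then have "\<forall>\<^sub>F N in sequentially. 2 * (1 + 1/t) * real N powr (-t) / (c/4)\<^sup>2 < \<epsilon> / 2"
      by (rule order_tendstoD) (use \<epsilon> in simp)
    moreover have "\<forall>\<^sub>F N in sequentially. y \<le> N" by (rule eventually_ge_at_top)
    ultimately show ?case
    proof eventually_elim
      case (elim N)
      have N0: "0 < N" using elim \<open>0 < y\<close> by simp
      let ?A = "{\<omega>\<in>space M. 1/4 \<le> \<bar>euler t y N \<omega> - 1\<bar>}"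
      let ?B = "{\<omega>\<in>space M. c/4 \<le> \<bar>smoothed \<alpha> N t \<omega> - euler t 0 N \<omega>\<bar>}"
      let ?E = "{\<omega>\<in>space M. \<not> (euler t 0 y \<omega> / 2 \<le> smoothed \<alpha> N t \<omega> \<and> smoothed \<alpha> N t \<omega> \<le> 2 * euler t 0 y \<omega>)}"
      have "?E \<subseteq> ?A \<union> ?B"
      proof (rule subsetI, rule ccontr)
        fix \<omega> assume \<omega>: "\<omega> \<in> ?E" "\<omega> \<notin> ?A \<union> ?B"
        then have A: "\<bar>euler t y N \<omega> - 1\<bar> \<le> 1/4" and B: "\<bar>smoothed \<alpha> N t \<omega> - euler t 0 N \<omega>\<bar> \<le> c/4" by auto
        let ?P = "euler t 0 y \<omega>"
        have "euler t 0 N \<omega> - ?P = ?P * (euler t y N \<omega> - 1)"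
          using euler_split[of 0 y N t \<omega>] elim by (simp add: right_diff_distrib)
        moreover have "0 < ?P" using cle[of \<omega>] c0 by linarith
        ultimately have "\<bar>euler t 0 N \<omega> - ?P\<bar> = ?P * \<bar>euler t y N \<omega> - 1\<bar>"
          by (simp add: abs_mult)
        also have "\<dots> \<le> ?P * (1/4)" using A cle[of \<omega>] c0 by (intro mult_left_mono) auto
        finally have "\<bar>smoothed \<alpha> N t \<omega> - ?P\<bar> \<le> ?P / 2" using B cle[of \<omega>] by linarith
        then have "?P / 2 \<le> smoothed \<alpha> N t \<omega> \<and> smoothed \<alpha> N t \<omega> \<le> 2 * ?P" using cle[of \<omega>] c0 by linarith
        then show False using \<omega>(1) by simp
      qed
      then have "prob ?E \<le> prob (?A \<union> ?B)" by (intro finite_measure_mono) measurable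
      also have "\<dots> \<le> prob ?A + prob ?B" by (intro measure_Un_le) measurable
      also have "prob ?A \<le> expectation (\<lambda>\<omega>. (euler t y N \<omega> - 1)\<^sup>2) / (1/4)\<^sup>2"
        by (intro second_moment_method expectation_euler_minus_one_sq t \<open>0 < y\<close>) auto
      also have "\<dots> \<le> (exp (real y powr (-2*t) / (2*t)) - 1) / (1/4)\<^sup>2"
        using t \<open>0 < y\<close> by (intro divide_right_mono expectation_euler_minus_one_sq) auto
      also have "prob ?B \<le> expectation (\<lambda>\<omega>. (smoothed \<alpha> N t \<omega> - euler t 0 N \<omega>)\<^sup>2) / (c/4)\<^sup>2"
        using c0 by (intro second_moment_method smoothed_minus_euler t \<alpha> N0) auto
      also have "\<dots> \<le> 2 * (1 + 1/t) * real N powr (-t) / (c/4)\<^sup>2"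
        by (intro divide_right_mono smoothed_minus_euler t \<alpha> N0) auto
      finally show ?case using elim \<open>16 * _ < _\<close> by (simp add: power2_eq_square)
    qed
  qed
qed

section \<open>Exponential moments and tails of signed sums\<close>

lemma
  assumes B: "finite B" "\<And>p. p \<in> B \<Longrightarrow> prime p"
  shows expectation_exp_sum: "expectation (\<lambda>\<omega>. exp (\<Sum>p\<in>B. a p * e p \<omega>)) = (\<Prod>p\<in>B. cosh (a p))"
    and integrable_exp_sum: "integrable M (\<lambda>\<omega>. exp (\<Sum>p\<in>B. a p * e p \<omega>))"
proof -
  have eq: "exp (\<Sum>p\<in>B. a p * e p \<omega>) = (\<Prod>p\<in>B. exp (a p * e p \<omega>))" for \<omega>
    using B(1) by (rule exp_sum)
  show "integrable M (\<lambda>\<omega>. exp (\<Sum>p\<in>B. a p * e p \<omega>))"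
    unfolding eq by (rule integrable_prod_e[OF B, of "\<lambda>p x. exp (a p * x)"])
  show "expectation (\<lambda>\<omega>. exp (\<Sum>p\<in>B. a p * e p \<omega>)) = (\<Prod>p\<in>B. cosh (a p))"
    unfolding eq
  proof (subst expectation_prod_e[OF B, of "\<lambda>p x. exp (a p * x)"])
    show "(\<Prod>p\<in>B. (exp (a p * 1) + exp (a p * -1)) / 2) = (\<Prod>p\<in>B. cosh (a p))"
      by (intro prod.cong refl) (simp add: cosh_def)
  qed
qed

text \<open>Chernoff's bound: Markov's inequality for the exponential of \<open>- l\<close> times
  the sum, each \<open>cosh\<close> factor being bounded by a Gaussian one.\<close>

lemma prob_sum_le:
  assumes B: "finite B" "\<And>p. p \<in> B \<Longrightarrow> prime p"
    and a: "\<And>p. p \<in> B \<Longrightarrow> \<bar>l * a p\<bar> \<le> 1"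
  shows "prob {\<omega>\<in>space M. l * (\<Sum>p\<in>B. a p * e p \<omega>) \<le> - x} \<le> exp (l\<^sup>2 * (\<Sum>p\<in>B. (a p)\<^sup>2) - x)"
proof -
  let ?Y = "\<lambda>\<omega>. exp (\<Sum>p\<in>B. (- l * a p) * e p \<omega>)"
  have eq: "(\<Sum>p\<in>B. (- l * a p) * e p \<omega>) = - (l * (\<Sum>p\<in>B. a p * e p \<omega>))" for \<omega>
    by (simp add: sum_distrib_left mult.assoc sum_negf)
  have "prob {\<omega>\<in>space M. l * (\<Sum>p\<in>B. a p * e p \<omega>) \<le> - x} = prob {\<omega>\<in>space M. exp x \<le> ?Y \<omega>}"
    unfolding eq exp_le_cancel_iff by (intro arg_cong[where f=prob]) auto
  also have "\<dots> \<le> expectation ?Y / exp x"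
    using integrable_exp_sum[OF B, of "\<lambda>p. - l * a p"] by (intro integral_Markov_inequality_measure[where A = "{}"]) auto
  also have "expectation ?Y = (\<Prod>p\<in>B. cosh (- l * a p))" by (rule expectation_exp_sum[OF B])
  also have "\<dots> \<le> (\<Prod>p\<in>B. exp (l\<^sup>2 * (a p)\<^sup>2))"
    using cosh_le_exp[of "l * a p" for p] a by (intro prod_mono) (auto simp: power_mult_distrib cosh_real_nonneg)
  also have "\<dots> = exp (l\<^sup>2 * (\<Sum>p\<in>B. (a p)\<^sup>2))" using B(1) by (simp add: exp_sum sum_distrib_left)
  finally show ?thesis by (simp add: exp_diff divide_right_mono)
qed

text \<open>The Paley--Zygmund inequality for \<open>exp (l * X)\<close>, where \<open>X\<close> is the signed sum.\<close>
lemma prob_sum_ge: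
  assumes B: "finite B" "\<And>p. p \<in> B \<Longrightarrow> prime p"
    and a: "\<And>p. p \<in> B \<Longrightarrow> \<bar>2 * l * a p\<bar> \<le> 1"
  defines "v \<equiv> \<Sum>p\<in>B. (a p)\<^sup>2"
  shows "exp (- 4 * l\<^sup>2 * v) / 4 \<le> prob {\<omega>\<in>space M. l\<^sup>2 * v / 4 - ln 2 \<le> l * (\<Sum>p\<in>B. a p * e p \<omega>)}"
proof -
  let ?X = "\<lambda>\<omega>. \<Sum>p\<in>B. a p * e p \<omega>"
  define Y where "Y = (\<lambda>\<omega>. exp (\<Sum>p\<in>B. (l * a p) * e p \<omega>))"
  have Yeq: "Y \<omega> = exp (l * ?X \<omega>)" for \<omega> by (simp add: Y_def sum_distrib_left mult.assoc)
  have Y2eq: "(Y \<omega>)\<^sup>2 = exp (\<Sum>p\<in>B. (2 * l * a p) * e p \<omega>)" for \<omega>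
    by (simp add: Y_def power2_eq_square sum_distrib_left mult.assoc flip: exp_add sum.distrib)
  have intY: "integrable M Y" unfolding Y_def by (rule integrable_exp_sum[OF B])
  have intY2: "integrable M (\<lambda>\<omega>. (Y \<omega>)\<^sup>2)" unfolding Y2eq by (rule integrable_exp_sum[OF B])
  define \<mu> where "\<mu> = expectation Y"
  define S where "S = expectation (\<lambda>\<omega>. (Y \<omega>)\<^sup>2)"
  have \<mu>: "\<mu> = (\<Prod>p\<in>B. cosh (l * a p))" unfolding \<mu>_def Y_def by (rule expectation_exp_sum[OF B])
  have S: "S = (\<Prod>p\<in>B. cosh (2 * l * a p))" unfolding S_def Y2eq by (rule expectation_exp_sum[OF B])
  have "(\<Prod>p\<in>B. exp ((l * a p)\<^sup>2 / 4)) \<le> \<mu>"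
    unfolding \<mu> using a by (intro prod_mono) (force intro!: cosh_ge_exp simp: abs_mult)
  then have \<mu>_ge: "exp (l\<^sup>2 * v / 4) \<le> \<mu>"
    using B(1) by (simp add: v_def power_mult_distrib sum_distrib_left sum_divide_distrib flip: exp_sum)
  have "S \<le> (\<Prod>p\<in>B. exp ((2 * l * a p)\<^sup>2))"
    unfolding S using a by (intro prod_mono) (auto intro!: cosh_le_exp simp: cosh_real_nonneg)
  then have S_le: "S \<le> exp (4 * l\<^sup>2 * v)"
    using B(1) by (simp add: v_def power_mult_distrib sum_distrib_left flip: exp_sum)
  have S_pos: "0 < S" unfolding S by (intro prod_pos) (auto simp: cosh_real_pos)
  have v0: "0 \<le> v" by (simp add: v_def sum_nonneg)
  have \<mu>1: "1 \<le> \<mu>" using \<mu>_ge one_le_exp_iff[of "l\<^sup>2 * v / 4"] v0 by (intro order.trans[OF _ \<mu>_ge]) auto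
  let ?A = "{\<omega>\<in>space M. \<mu> / 2 \<le> Y \<omega>}"
  have [measurable]: "Y \<in> borel_measurable M" using intY by auto
  \<comment> \<open>In the role of Cauchy-Schwarz, \<open>Y \<le> Y^2 / (2 * r) + r / 2\<close> is
    used on the event and \<open>Y \<le> \<mu> / 2\<close> off it. This \<open>r\<close> makes
    \<open>S / (2 * r)\<close> equal to \<open>\<mu> / 4\<close>, which leaves a quarter of
    \<open>\<mu>\<close> for the probability.\<close>
  define r where "r = 2 * S / \<mu>"
  have r0: "0 < r" using S_pos \<mu>1 by (simp add: r_def)
  have pt: "Y \<omega> \<le> \<mu> / 2 + (Y \<omega>)\<^sup>2 / (2 * r) + r / 2 * indicator ?A \<omega>" if "\<omega> \<in> space M" for \<omega>
  proof -
    have "0 \<le> (Y \<omega> - r)\<^sup>2 / (2*r)" using r0 by simp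
    also have "\<dots> = (Y \<omega>)\<^sup>2 / (2 * r) + r / 2 - Y \<omega>" using r0 by (simp add: power2_eq_square field_simps)
    finally have "Y \<omega> \<le> (Y \<omega>)\<^sup>2 / (2 * r) + r / 2" by simp
    moreover have "0 \<le> (Y \<omega>)\<^sup>2 / (2 * r)" using r0 by simp
    ultimately show ?thesis using \<mu>1 that by (cases "\<mu> / 2 \<le> Y \<omega>") auto
  qed
  have "\<mu> \<le> expectation (\<lambda>\<omega>. \<mu> / 2 + (Y \<omega>)\<^sup>2 / (2 * r) + r / 2 * indicator ?A \<omega>)"
    unfolding \<mu>_def using pt[unfolded \<mu>_def] intY intY2 
    by (intro integral_mono) (auto intro!: Bochner_Integration.integrable_add integrable_real_indicator simp: emeasure_eq_measure)
  also have "\<dots> = \<mu> / 2 + S / (2*r) + r / 2 * prob ?A"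
    using intY2 by (simp add: S_def prob_space emeasure_eq_measure)
  also have "S / (2*r) = \<mu> / 4" using S_pos \<mu>1 by (simp add: r_def)
  finally have "\<mu>\<^sup>2 / (4 * S) \<le> prob ?A" using S_pos \<mu>1 by (simp add: r_def field_simps power2_eq_square)
  moreover have "exp (- 4 * l\<^sup>2 * v) / 4 \<le> \<mu>\<^sup>2 / (4 * S)"
  proof -
    have "exp (- 4 * l\<^sup>2 * v) * S \<le> exp (- 4 * l\<^sup>2 * v) * exp (4 * l\<^sup>2 * v)"
      using S_le by (intro mult_left_mono) auto
    also have "\<dots> = 1" by (simp flip: exp_add)
    also have "\<dots> \<le> \<mu>\<^sup>2" using \<mu>1 by (rule one_le_power)
    finally show ?thesis using S_pos by (simp add: field_simps)
  qed
  moreover have "prob ?A \<le> prob {\<omega>\<in>space M. l\<^sup>2 * v / 4 - ln 2 \<le> l * ?X \<omega>}"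
  proof (rule finite_measure_mono)
    show "?A \<subseteq> {\<omega>\<in>space M. l\<^sup>2 * v / 4 - ln 2 \<le> l * ?X \<omega>}"
    proof safe
      fix \<omega> assume "\<mu> / 2 \<le> Y \<omega>"
      then have "exp (l\<^sup>2 * v / 4) / 2 \<le> exp (l * ?X \<omega>)" using \<mu>_ge by (simp add: Yeq)
      then have "exp (l\<^sup>2 * v / 4 - ln 2) \<le> exp (l * ?X \<omega>)" by (simp add: exp_diff)
      then show "l\<^sup>2 * v / 4 - ln 2 \<le> l * ?X \<omega>" by simp
    qed
    have [measurable]: "?X \<in> borel_measurable M" using B(2) by (intro borel_measurable_sum borel_measurable_times) auto
    show "{\<omega>\<in>space M. l\<^sup>2 * v / 4 - ln 2 \<le> l * ?X \<omega>} \<in> events" by measurable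
  qed
  ultimately show ?thesis by linarith
qed

lemma ln_euler:
  assumes "0 \<le> t"
  shows "ln (euler t a y \<omega>) = (\<Sum>p\<in>primes_in a y. ln (1 - (pw t p)\<^sup>2)) / 2 + (\<Sum>p\<in>primes_in a y. artanh (pw t p) * e p \<omega>)"
proof -
  have "ln (euler t a y \<omega>) = (\<Sum>p\<in>primes_in a y. ln (1 + e p \<omega> * pw t p))"
    unfolding euler_def using euler_factor_pos(1)[OF _ assms] by (intro ln_prod) (auto simp: less_imp_neq[symmetric])
  also have "\<dots> = (\<Sum>p\<in>primes_in a y. ln (1 - (pw t p)\<^sup>2) / 2 + artanh (pw t p) * e p \<omega>)"
    using assms pw_le1 pw_pos primes_in_ge_2 sign
    by (intro sum.cong refl) (subst ln_one_plus_sign, auto simp: less_imp_le)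
  finally show ?thesis by (simp add: sum.distrib sum_divide_distrib)
qed

lemma euler_pos: "0 \<le> t \<Longrightarrow> 0 < euler t a y \<omega>"
  unfolding euler_def by (intro prod_pos euler_factor_pos)

text \<open>With \<open>L = ln (1/t)\<close>, the deterministic part of the logarithm is at least
  \<open>-(L + 7) / 2\<close>. A product this small therefore forces the signed sum below
  \<open>- L / 4\<close>, a large deviation. The exponent \<open>3/4\<close> lies above
  \<open>1/2\<close> for this reason, and below 1 so that errors of order \<open>t\<close> are
  negligible against the product.\<close>

lemma prob_euler_small:
  assumes t: "0 < t" "2 * t \<le> 1"
  shows "prob {\<omega>\<in>space M. euler t 0 y \<omega> < exp (-7/2) * t powr (3/4)} \<le> exp 1 * t powr (1/256)"
proof -
  define L where "L = ln (1/t)"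
  define b where "b p = artanh (pw t p)" for p
  have L: "L = - ln t" using t by (simp add: L_def ln_div)
  have b: "0 \<le> b p \<and> b p \<le> 2 * pw t p" if "p \<in> primes_in 0 y" for p
    using artanh_diff_bounds[of 0 "pw t p"] pw_sq_le[of p t] pw_pos[of p t] primes_in_ge_2[OF that] t
    by (auto simp: b_def)
  have ps: "prime_sum y (2*t) \<le> L + 3"
  proof -
    have "prime_sum y (2*t) \<le> ln (1/(2*t)) + 3" using t by (intro prime_sum_le) auto
    also have "ln (1/(2*t)) \<le> L" using t by (simp add: L ln_div ln_mult)
    finally show ?thesis by simp
  qed
  have "(\<Sum>p\<in>primes_in 0 y. (b p)\<^sup>2) \<le> (\<Sum>p\<in>primes_in 0 y. 4 * (pw t p)\<^sup>2)"
  proof (rule sum_mono)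
    fix p assume "p \<in> primes_in 0 y"
    then show "(b p)\<^sup>2 \<le> 4 * (pw t p)\<^sup>2"
      using b[of p] power_mono[of "b p" "2 * pw t p" 2] by (simp add: power_mult_distrib)
  qed
  also have "\<dots> = 4 * prime_sum y (2*t)" by (simp add: sum_pw_sq flip: sum_distrib_left)
  finally have bsum: "(\<Sum>p\<in>primes_in 0 y. (b p)\<^sup>2) \<le> 4 * (L + 3)" using ps by simp
  \<comment> \<open>Chernoff's bound with \<open>l = 1/32\<close> has variance term at most
    \<open>4 * (L + 3) / 1024\<close>, whose main part is half of the gain \<open>L / 128\<close>.
    The factor \<open>exp (-7/2)\<close> cancels the constant in the deterministic part.\<close>
  have sub: "{\<omega>\<in>space M. euler t 0 y \<omega> < exp (-7/2) * t powr (3/4)} \<subseteq>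
    {\<omega>\<in>space M. 1/32 * (\<Sum>p\<in>primes_in 0 y. b p * e p \<omega>) \<le> - (L/128)}"
  proof safe
    fix \<omega> assume "euler t 0 y \<omega> < exp (-7/2) * t powr (3/4)"
    then have "ln (euler t 0 y \<omega>) < ln (exp (-7/2) * t powr (3/4))"
      using euler_pos[of t 0 y \<omega>] t by (subst ln_less_cancel_iff) auto
    then have 1: "ln (euler t 0 y \<omega>) < -7/2 - 3/4 * L" using t by (simp add: ln_mult L ln_powr)
    have "(\<Sum>p\<in>primes_in 0 y. - (pw t p)\<^sup>2 - 2 * real p powr (-2)) \<le> (\<Sum>p\<in>primes_in 0 y. ln (1 - (pw t p)\<^sup>2))"
    proof (rule sum_mono)
      fix p assume p: "p \<in> primes_in 0 y"
      let ?u = "(pw t p)\<^sup>2"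
      have u: "0 \<le> ?u" "?u \<le> 1/2" using pw_sq_le[of p t] primes_in_ge_2[OF p] t by auto
      have "?u \<le> real p powr (-1)" unfolding pw_sq using primes_in_ge_2[OF p] t by (intro powr_mono) auto
      then have "?u\<^sup>2 \<le> (real p powr (-1))\<^sup>2" using u by (intro power_mono) auto
      also have "\<dots> = real p powr (-2)" by (simp only: power2_eq_square powr_add[symmetric]) simp
      finally show "- ?u - 2 * real p powr (-2) \<le> ln (1 - ?u)"
        using ln_one_minus_pos_lower_bound[OF u] by linarith
    qed
    also have "(\<Sum>p\<in>primes_in 0 y. - (pw t p)\<^sup>2 - 2 * real p powr (-2)) = 
        - prime_sum y (2*t) - 2 * (\<Sum>p\<in>primes_in 0 y. real p powr (-2))"
      by (simp add: sum_subtractf sum_negf sum_pw_sq sum_distrib_left)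
    finally have "- (L + 3) - 4 \<le> (\<Sum>p\<in>primes_in 0 y. ln (1 - (pw t p)\<^sup>2))"
      using ps sum_primes_square_le[of 0 y] by linarith
    then have "(\<Sum>p\<in>primes_in 0 y. b p * e p \<omega>) \<le> - L / 4"
      using 1 ln_euler[of t 0 y \<omega>] t by (simp add: b_def)
    then show "1/32 * (\<Sum>p\<in>primes_in 0 y. b p * e p \<omega>) \<le> - (L/128)" by simp
  qed
  have [measurable]: "(\<lambda>\<omega>. \<Sum>p\<in>primes_in 0 y. b p * e p \<omega>) \<in> borel_measurable M"
    by (intro borel_measurable_sum borel_measurable_times) (auto simp: primes_inD)
  have "prob {\<omega>\<in>space M. euler t 0 y \<omega> < exp (-7/2) * t powr (3/4)} \<le>
      prob {\<omega>\<in>space M. 1/32 * (\<Sum>p\<in>primes_in 0 y. b p * e p \<omega>) \<le> - (L/128)}"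
    by (rule finite_measure_mono[OF sub]) measurable
  also have "\<dots> \<le> exp ((1/32)\<^sup>2 * (\<Sum>p\<in>primes_in 0 y. (b p)\<^sup>2) - L/128)"
  proof (rule prob_sum_le)
    fix p assume p: "p \<in> primes_in 0 y"
    then have "b p \<le> 2" using b[OF p] pw_le1[of p t] primes_in_ge_2[OF p] t by auto
    then show "\<bar>1/32 * b p\<bar> \<le> 1" using b[OF p] by simp
  qed (auto simp: primes_inD)
  also have "\<dots> \<le> exp (1 + ln t * (1/256))"
    unfolding exp_le_cancel_iff using bsum L by (simp add: power2_eq_square)
  also have "\<dots> = exp 1 * t powr (1/256)" using t by (simp add: exp_add powr_def)
  finally show ?thesis .
qed

end

section \<open>Fluctuation of the ratio of Euler products\<close>

text \<open>The coefficient of the sign at \<open>p\<close> in the logarithm of the ratio of the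
  Euler products at \<open>1/2 + s\<close> and \<open>1/2 + K * s\<close>.\<close>

definition log_coeff :: "real \<Rightarrow> real \<Rightarrow> nat \<Rightarrow> real" where
  "log_coeff K s p = artanh (pw s p) - artanh (pw (K * s) p)"

lemma log_coeff_bounds:
  assumes "2 \<le> p" "0 < s" "1 \<le> K"
  shows "pw s p - pw (K * s) p \<le> log_coeff K s p" "0 \<le> log_coeff K s p"
    "log_coeff K s p \<le> 2 * (pw s p - pw (K * s) p)" "log_coeff K s p \<le> 4 * K * s"
proof -
  have le: "pw (K * s) p \<le> pw s p" using assms by (intro pw_antimono) auto
  have *: "pw s p - pw (K * s) p \<le> log_coeff K s p" "log_coeff K s p \<le> 2 * (pw s p - pw (K * s) p)"
    using artanh_diff_bounds[of "pw (K * s) p" "pw s p"] le pw_sq_le[of p s] pw_pos[of p "K * s"] assms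
    by (auto simp: log_coeff_def)
  show "pw s p - pw (K * s) p \<le> log_coeff K s p" "0 \<le> log_coeff K s p"
    "log_coeff K s p \<le> 2 * (pw s p - pw (K * s) p)" "log_coeff K s p \<le> 4 * K * s"
    using * le pw_diff_le[of p s K] assms by auto
qed

lemma card_primes_in_le: "card (primes_in 0 y) \<le> y"
proof -
  have "primes_in 0 y \<subseteq> {1..y}" by (auto simp: primes_in_def)
  then have "card (primes_in 0 y) \<le> card {1..y}" by (intro card_mono) auto
  then show ?thesis by simp
qed

context random_signs
begin

definition block_sum :: "real \<Rightarrow> real \<Rightarrow> nat \<Rightarrow> nat \<Rightarrow> 'a \<Rightarrow> real" where
  "block_sum K s a b \<omega> = (\<Sum>p\<in>primes_in a b. log_coeff K s p * e p \<omega>)"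

lemma borel_measurable_block_sum [measurable]: "block_sum K s a b \<in> borel_measurable M"
  unfolding block_sum_def[abs_def]
  by (intro borel_measurable_sum borel_measurable_times) (auto simp: primes_inD)

text \<open>The deterministic part of the logarithm lies in \<open>[-V, 0]\<close>. There are at
  most \<open>a\<close> primes up to \<open>a\<close>, each with coefficient at most
  \<open>4 * K * s\<close>, so together they contribute at most 1. All fluctuation beyond these
  constants comes from the primes above \<open>a\<close>.\<close>

lemma ln_euler_ratio_bounds:
  fixes \<omega> :: 'a
  assumes s: "0 < s" "1 \<le> K" and y: "a \<le> y" 
    and head: "4 * K * s * real a \<le> 1"
    and V: "(\<Sum>p\<in>primes_in 0 y. (pw s p)\<^sup>2 - (pw (K * s) p)\<^sup>2) \<le> V"
  defines "R \<equiv> ln (euler s 0 y \<omega>) - ln (euler (K * s) 0 y \<omega>)"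
  shows "block_sum K s a y \<omega> - 1 - V \<le> R" "R \<le> block_sum K s a y \<omega> + 1"
proof -
  let ?m = "\<Sum>p\<in>primes_in 0 y. ln (1 - (pw s p)\<^sup>2) - ln (1 - (pw (K * s) p)\<^sup>2)"
  have Ks: "0 \<le> K * s" using s by simp
  have "R = ?m / 2 + block_sum K s 0 y \<omega>"
    using s Ks by (simp add: R_def ln_euler block_sum_def log_coeff_def left_diff_distrib sum_subtractf diff_divide_distrib)
  also have "block_sum K s 0 y \<omega> = block_sum K s 0 a \<omega> + block_sum K s a y \<omega>"
    unfolding block_sum_def primes_in_split(1)[OF le0 y]
    by (rule sum.union_disjoint) (use primes_in_split(2)[OF le0 y] in auto)
  finally have R: "R = ?m / 2 + block_sum K s 0 a \<omega> + block_sum K s a y \<omega>" by simp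
  have summand: "- 2 * ((pw s p)\<^sup>2 - (pw (K * s) p)\<^sup>2) \<le> ln (1 - (pw s p)\<^sup>2) - ln (1 - (pw (K * s) p)\<^sup>2)
       \<and> ln (1 - (pw s p)\<^sup>2) - ln (1 - (pw (K * s) p)\<^sup>2) \<le> 0" if p: "p \<in> primes_in 0 y" for p
  proof -
    define u v where "u = (pw s p)\<^sup>2" and "v = (pw (K * s) p)\<^sup>2"
    have p2: "2 \<le> p" using p by (rule primes_in_ge_2)
    have u: "u \<le> 1/2" unfolding u_def using s p2 by (intro pw_sq_le) auto
    have "v \<le> u" unfolding u_def v_def using pw_antimono[OF p2, of s "K * s"] pw_pos[OF p2, of "K * s"] s
      by (intro power_mono) auto
    then have "ln (1 - v) - ln (1 - u) = ln ((1 - v) / (1 - u))" using u by (simp add: ln_div)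
    also have "(1 - v) / (1 - u) = 1 + (u - v) / (1 - u)" using u by (simp add: field_simps)
    also have "ln (1 + (u - v) / (1 - u)) \<le> (u - v) / (1 - u)" using u \<open>v \<le> u\<close> by (intro ln_add_one_self_le_self) auto
    also have "\<dots> \<le> (u - v) / (1/2)" using u \<open>v \<le> u\<close> by (intro divide_left_mono) auto
    finally show ?thesis using u \<open>v \<le> u\<close> unfolding u_def[symmetric] v_def[symmetric] by simp
  qed
  have m: "?m \<le> 0" using summand by (intro sum_nonpos) auto
  have "- 2 * V \<le> (\<Sum>p\<in>primes_in 0 y. - 2 * ((pw s p)\<^sup>2 - (pw (K * s) p)\<^sup>2))"
    unfolding sum_distrib_left[symmetric] using V by simp
  also have "\<dots> \<le> ?m" using summand by (intro sum_mono) auto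
  finally have m': "- 2 * V \<le> ?m" .
  have "\<bar>block_sum K s 0 a \<omega>\<bar> \<le> (\<Sum>p\<in>primes_in 0 a. \<bar>log_coeff K s p * e p \<omega>\<bar>)"
    unfolding block_sum_def by (rule sum_abs)
  also have "\<dots> \<le> (\<Sum>p\<in>primes_in 0 a. 4 * K * s)"
  proof (rule sum_mono)
    fix p assume "p \<in> primes_in 0 a"
    then show "\<bar>log_coeff K s p * e p \<omega>\<bar> \<le> 4 * K * s"
      using log_coeff_bounds[OF primes_in_ge_2 s] sign[of p \<omega>] by (auto simp: abs_mult)
  qed
  also have "\<dots> \<le> 4 * K * s * real a" using s card_primes_in_le[of a] by (simp add: mult_ac)
  finally have "\<bar>block_sum K s 0 a \<omega>\<bar> \<le> 1" using head by linarith
  then show "block_sum K s a y \<omega> - 1 - V \<le> R" "R \<le> block_sum K s a y \<omega> + 1"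
    using R m m' by auto
qed

text \<open>Dropping the primes up to \<open>a\<close> costs at most half of the first sum, so the
  variance of the block lies between \<open>1/2\<close> and \<open>4 * V\<close> and
  \<open>prob_sum_ge\<close> applies. The resulting bound is free of \<open>s\<close>,
  \<open>a\<close> and \<open>y\<close>, hence the same for all scales.\<close>

lemma prob_block_sum_ge:
  assumes c: "0 < c" and s: "0 < s" "1 \<le> K" and y: "a \<le> y"
    and l: "64 * (c + 1) * K * s \<le> 1" and head: "real a * (2 * K * s)\<^sup>2 \<le> 1/2"
    and ge: "1 \<le> (\<Sum>p\<in>primes_in 0 y. (pw s p - pw (K * s) p)\<^sup>2)"
    and V: "(\<Sum>p\<in>primes_in 0 y. (pw s p)\<^sup>2 - (pw (K * s) p)\<^sup>2) \<le> V"
  shows "exp (- 1024 * (c + 1)\<^sup>2 * V) / 4 \<le> prob {\<omega>\<in>space M. c \<le> block_sum K s a y \<omega>}"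
    and "exp (- 1024 * (c + 1)\<^sup>2 * V) / 4 \<le> prob {\<omega>\<in>space M. block_sum K s a y \<omega> \<le> - c}"
proof -
  define B where "B = primes_in a y"
  have B: "finite B" "\<And>p. p \<in> B \<Longrightarrow> prime p" by (auto simp: B_def primes_inD)
  define v where "v = (\<Sum>p\<in>B. (log_coeff K s p)\<^sup>2)"
  let ?d = "\<lambda>p. pw s p - pw (K * s) p"
  have d0: "0 \<le> ?d p" if "2 \<le> p" for p using that s pw_antimono[of p s "K * s"] by auto
  have "(\<Sum>p\<in>primes_in 0 a. (?d p)\<^sup>2) \<le> (\<Sum>p\<in>primes_in 0 a. (2 * K * s)\<^sup>2)"
    using d0 pw_diff_le[of _ s K] s by (intro sum_mono power_mono) (auto dest: primes_in_ge_2)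
  also have "\<dots> \<le> real a * (2 * K * s)\<^sup>2" using card_primes_in_le[of a] by (simp add: mult_right_mono)
  finally have h: "(\<Sum>p\<in>primes_in 0 a. (?d p)\<^sup>2) \<le> 1/2" using head by simp
  have split: "(\<Sum>p\<in>primes_in 0 y. (?d p)\<^sup>2) = (\<Sum>p\<in>primes_in 0 a. (?d p)\<^sup>2) + (\<Sum>p\<in>B. (?d p)\<^sup>2)"
    unfolding B_def primes_in_split(1)[OF le0 y]
    by (rule sum.union_disjoint) (use primes_in_split(2)[OF le0 y] in auto)
  have "(\<Sum>p\<in>B. (?d p)\<^sup>2) \<le> v" unfolding v_def
    using log_coeff_bounds(1)[OF primes_in_ge_2 s] d0 by (intro sum_mono power_mono) (auto simp: B_def dest: primes_in_ge_2)
  then have v_ge: "1/2 \<le> v" using h split ge by linarith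
  have "v \<le> (\<Sum>p\<in>B. 4 * (?d p)\<^sup>2)" unfolding v_def
  proof (rule sum_mono)
    fix p assume "p \<in> B"
    then have p: "2 \<le> p" by (auto simp: B_def dest: primes_in_ge_2)
    have "(log_coeff K s p)\<^sup>2 \<le> (2 * ?d p)\<^sup>2"
      using log_coeff_bounds[OF p s] by (intro power_mono) auto
    then show "(log_coeff K s p)\<^sup>2 \<le> 4 * (?d p)\<^sup>2" by (simp only: power_mult_distrib) simp
  qed
  also have "\<dots> \<le> 4 * (\<Sum>p\<in>primes_in 0 y. (?d p)\<^sup>2)"
    unfolding split by (simp add: sum_distrib_left[symmetric] sum_nonneg)
  also have "(\<Sum>p\<in>primes_in 0 y. (?d p)\<^sup>2) \<le> (\<Sum>p\<in>primes_in 0 y. (pw s p)\<^sup>2 - (pw (K * s) p)\<^sup>2)"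
  proof (rule sum_mono)
    fix p assume "p \<in> primes_in 0 y"
    then have p: "2 \<le> p" by (rule primes_in_ge_2)
    have "?d p * ?d p \<le> ?d p * (pw s p + pw (K * s) p)"
      using d0[OF p] pw_pos[OF p, of "K * s"] by (intro mult_left_mono) auto
    then show "(?d p)\<^sup>2 \<le> (pw s p)\<^sup>2 - (pw (K * s) p)\<^sup>2" by (simp add: power2_eq_square algebra_simps)
  qed
  finally have v_le: "v \<le> 4 * V" using V by simp
  have main: "exp (- 1024 * (c + 1)\<^sup>2 * V) / 4 \<le> prob {\<omega>\<in>space M. c \<le> \<sigma> * block_sum K s a y \<omega>}"
    if \<sigma>: "\<sigma> = 1 \<or> \<sigma> = -1" for \<sigma> :: real
  proof -
    \<comment> \<open>As \<open>v \<ge> 1/2\<close>, this choice gives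
      \<open>l^2 * v / 4 \<ge> l * (c + 1)\<close>, which exceeds \<open>l * c + ln 2\<close>; and
      \<open>v \<le> 4 * V\<close> gives
      \<open>4 * l^2 * v \<le> 1024 * (c + 1)^2 * V\<close>.\<close>
    define l where "l = 8 * (c + 1)"
    let ?a = "\<lambda>p. \<sigma> * log_coeff K s p"
    have l0: "8 \<le> l" using c by (simp add: l_def)
    have abs: "\<bar>2 * l * ?a p\<bar> \<le> 1" if "p \<in> B" for p
    proof -
      have p: "2 \<le> p" using that by (auto simp: B_def dest: primes_in_ge_2)
      have "\<bar>2 * l * ?a p\<bar> = 2 * l * log_coeff K s p"
        using \<sigma> l0 log_coeff_bounds[OF p s] by (auto simp: abs_mult)
      also have "\<dots> \<le> 2 * l * (4 * K * s)" using l0 log_coeff_bounds[OF p s] by (intro mult_left_mono) auto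
      also have "\<dots> \<le> 1" using l by (simp add: l_def mult_ac)
      finally show ?thesis .
    qed
    have veq: "(\<Sum>p\<in>B. (?a p)\<^sup>2) = v" unfolding v_def using \<sigma> by (auto simp: power_mult_distrib)
    have lsq: "l\<^sup>2 = 64 * (c + 1)\<^sup>2" by (simp only: l_def power_mult_distrib) simp
    have "l\<^sup>2 * v \<le> l\<^sup>2 * (4 * V)" using v_le by (intro mult_left_mono) auto
    then have "exp (- 1024 * (c + 1)\<^sup>2 * V) \<le> exp (- 4 * l\<^sup>2 * v)"
      unfolding exp_le_cancel_iff lsq by linarith
    then have "exp (- 1024 * (c + 1)\<^sup>2 * V) / 4 \<le> exp (- 4 * l\<^sup>2 * v) / 4" by simp
    also have "\<dots> \<le> prob {\<omega>\<in>space M. l\<^sup>2 * v / 4 - ln 2 \<le> l * (\<Sum>p\<in>B. ?a p * e p \<omega>)}"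
      using prob_sum_ge[of B l ?a] B abs unfolding veq by blast
    also have "\<dots> \<le> prob {\<omega>\<in>space M. c \<le> \<sigma> * block_sum K s a y \<omega>}"
    proof (rule finite_measure_mono)
      show "{\<omega>\<in>space M. l\<^sup>2 * v / 4 - ln 2 \<le> l * (\<Sum>p\<in>B. ?a p * e p \<omega>)} \<subseteq> {\<omega>\<in>space M. c \<le> \<sigma> * block_sum K s a y \<omega>}"
      proof safe
        fix \<omega> assume *: "l\<^sup>2 * v / 4 - ln 2 \<le> l * (\<Sum>p\<in>B. ?a p * e p \<omega>)"
        have "l * c + 1 \<le> l * (l / 8)" using l0 by (simp add: l_def algebra_simps)
        also have "\<dots> = l\<^sup>2 * (1/2) / 4" by (simp add: power2_eq_square)
        also have "\<dots> \<le> l\<^sup>2 * v / 4" using v_ge by (intro divide_right_mono mult_left_mono) auto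
        finally have "l * c \<le> l * (\<Sum>p\<in>B. ?a p * e p \<omega>)" using * ln_2_less_1 by linarith
        then have "c \<le> (\<Sum>p\<in>B. ?a p * e p \<omega>)" using l0 by simp
        then show "c \<le> \<sigma> * block_sum K s a y \<omega>" by (simp add: block_sum_def B_def sum_distrib_left mult.assoc)
      qed
    qed measurable
    finally show ?thesis .
  qed
  show "exp (- 1024 * (c + 1)\<^sup>2 * V) / 4 \<le> prob {\<omega>\<in>space M. c \<le> block_sum K s a y \<omega>}"
    using main[of 1] by simp
  have "{\<omega>\<in>space M. c \<le> - 1 * block_sum K s a y \<omega>} = {\<omega>\<in>space M. block_sum K s a y \<omega> \<le> - c}" by auto
  then show "exp (- 1024 * (c + 1)\<^sup>2 * V) / 4 \<le> prob {\<omega>\<in>space M. block_sum K s a y \<omega> \<le> - c}"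
    using main[of "-1"] by simp
qed

text \<open>Besides the two failed approximations, this includes the event that the Euler product at
  \<open>K * s\<close> does not dominate \<open>real k * s\<close>. The factor \<open>k\<close>
  grows along the scales, so that it eventually beats the constant in the partial summation error,
  which depends on the sample point.\<close>

definition exceptional :: "real \<Rightarrow> real \<Rightarrow> nat \<Rightarrow> real \<Rightarrow> nat \<Rightarrow> nat \<Rightarrow> 'a set" where
  "exceptional \<alpha> K k s y N =
    {\<omega>\<in>space M. \<not> (euler s 0 y \<omega> / 2 \<le> smoothed \<alpha> N s \<omega> \<and> smoothed \<alpha> N s \<omega> \<le> 2 * euler s 0 y \<omega>)} \<union>
    {\<omega>\<in>space M. \<not> (euler (K * s) 0 y \<omega> / 2 \<le> smoothed \<alpha> N (K * s) \<omega> \<and> smoothed \<alpha> N (K * s) \<omega> \<le> 2 * euler (K * s) 0 y \<omega>)} \<union>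
    {\<omega>\<in>space M. euler (K * s) 0 y \<omega> < real k * s}"

lemma sets_exceptional [measurable]: "exceptional \<alpha> K k s y N \<in> events"
  unfolding exceptional_def by measurable

text \<open>The choices come in the order \<open>s\<close>, \<open>y\<close>, \<open>N\<close>:
  first \<open>s\<close> small in terms of \<open>a\<close> and \<open>k\<close>, then
  \<open>y\<close> for the variance bounds and the first approximation step, then \<open>N\<close>
  in terms of \<open>y\<close>. As \<open>a\<close> is arbitrary, blocks of primes can be
  stacked.\<close>

lemma scale_exists:
  assumes \<alpha>: "\<alpha> \<le> 1/2" and K: "1 < K" and c: "0 < c"
    and sep: "\<And>s. 0 < s \<Longrightarrow> 2 * K * s \<le> 1 \<Longrightarrow> \<forall>\<^sub>F y in sequentially.
        1 \<le> (\<Sum>p\<in>primes_in 0 y. (pw s p - pw (K * s) p)\<^sup>2) \<and>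
        (\<Sum>p\<in>primes_in 0 y. (pw s p)\<^sup>2 - (pw (K * s) p)\<^sup>2) \<le> V"
  shows "\<exists>s y N. 0 < s \<and> 2 * s \<le> 1 \<and> a < y \<and> prob (exceptional \<alpha> K k s y N) \<le> (1/2)^k \<and>
    exp (- 1024 * (c + 1)\<^sup>2 * V) / 4 \<le> prob {\<omega>\<in>space M. c \<le> block_sum K s a y \<omega>} \<and>
    exp (- 1024 * (c + 1)\<^sup>2 * V) / 4 \<le> prob {\<omega>\<in>space M. block_sum K s a y \<omega> \<le> - c} \<and>
    (\<forall>\<omega>. block_sum K s a y \<omega> - 1 - V \<le> ln (euler s 0 y \<omega>) - ln (euler (K * s) 0 y \<omega>) \<and>
         ln (euler s 0 y \<omega>) - ln (euler (K * s) 0 y \<omega>) \<le> block_sum K s a y \<omega> + 1)"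
proof -
  \<comment> \<open>One third for each of the three events that make up
    \<open>exceptional\<close>.\<close>
  define \<epsilon> :: real where "\<epsilon> = (1/2)^k / 3"
  have \<epsilon>: "0 < \<epsilon>" by (simp add: \<epsilon>_def)
  have ev0: "\<forall>\<^sub>F s in at_right 0. f s < b" if "(f \<longlongrightarrow> 0) (at_right (0::real))" "0 < b" for f :: "real \<Rightarrow> real" and b
    using order_tendstoD(2)[OF that(1), of b] that(2) by simp
  have pw0: "((\<lambda>s. (C * s) powr d) \<longlongrightarrow> 0) (at_right 0)" if "0 < C" "0 < d" for C d :: real
  proof -
    have "((\<lambda>s. (C * s) powr d) \<longlongrightarrow> (C * 0) powr d) (at_right 0)"
      using that by (intro tendsto_powr' tendsto_intros) (auto simp: eventually_at_filter)
    then show ?thesis by simp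
  qed
  have lin: "((\<lambda>s. C * s) \<longlongrightarrow> 0) (at_right (0::real))" for C :: real
    by (rule tendsto_mult_right_zero[OF tendsto_ident_at])
  have "\<forall>\<^sub>F s in at_right 0. 0 < s" by (simp add: eventually_at_filter)
  moreover have "\<forall>\<^sub>F s in at_right 0. 2 * K * s < 1" by (rule ev0[OF lin]) simp
  moreover have "\<forall>\<^sub>F s in at_right 0. (64 * (c + 1) * K) * s < 1" by (rule ev0[OF lin]) simp
  moreover have "\<forall>\<^sub>F s in at_right 0. (4 * K * real a) * s < 1" by (rule ev0[OF lin]) simp
  moreover have "\<forall>\<^sub>F s in at_right 0. real a * (2 * K * s)\<^sup>2 < 1/2"
  proof (rule ev0)
    have "((\<lambda>s. real a * (2 * K * s)\<^sup>2) \<longlongrightarrow> real a * (2 * K * 0)\<^sup>2) (at_right 0)" by (intro tendsto_intros)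
    then show "((\<lambda>s. real a * (2 * K * s)\<^sup>2) \<longlongrightarrow> 0) (at_right 0)" by simp
  qed simp
  moreover have "\<forall>\<^sub>F s in at_right 0. exp 1 * (K * s) powr (1/256) < \<epsilon>"
    using K \<epsilon> by (intro ev0 tendsto_mult_right_zero pw0) auto
  moreover have "\<forall>\<^sub>F s in at_right 0. real k * (1 * s) powr (1/4) < exp (-7/2)"
    by (intro ev0 tendsto_mult_right_zero pw0) auto
  ultimately have "\<forall>\<^sub>F s in at_right 0. 0 < s \<and> 2 * K * s < 1 \<and> (64 * (c + 1) * K) * s < 1 \<and> (4 * K * real a) * s < 1 \<and>
      real a * (2 * K * s)\<^sup>2 < 1/2 \<and> exp 1 * (K * s) powr (1/256) < \<epsilon> \<and> real k * (1 * s) powr (1/4) < exp (-7/2)"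
    by eventually_elim simp
  then obtain s where s: "0 < s" "2 * K * s < 1" "(64 * (c + 1) * K) * s < 1" "(4 * K * real a) * s < 1"
      "real a * (2 * K * s)\<^sup>2 < 1/2" "exp 1 * (K * s) powr (1/256) < \<epsilon>" "real k * s powr (1/4) < exp (-7/2)"
    using eventually_happens'[OF trivial_limit_at_right_real[of "0::real"]] by auto
  have Ks: "0 < K * s" "s < K * s" using s(1) K by auto
  \<comment> \<open>Here the exponent \<open>3/4\<close> below 1 matters: the spare factor
    \<open>s powr (1/4)\<close> absorbs \<open>k\<close>.\<close>
  have ks: "real k * s \<le> exp (-7/2) * (K * s) powr (3/4)"
  proof -
    have "real k * s = real k * s powr (1/4) * s powr (3/4)" using s(1) by (simp add: mult.assoc flip: powr_add)
    also have "\<dots> \<le> exp (-7/2) * (K * s) powr (3/4)"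
      using s(1,7) Ks by (intro mult_mono powr_mono2) auto
    finally show ?thesis .
  qed
  have "\<forall>\<^sub>F y in sequentially. a < y" by (rule eventually_gt_at_top)
  moreover have "\<forall>\<^sub>F y in sequentially. 1 \<le> (\<Sum>p\<in>primes_in 0 y. (pw s p - pw (K * s) p)\<^sup>2) \<and>
        (\<Sum>p\<in>primes_in 0 y. (pw s p)\<^sup>2 - (pw (K * s) p)\<^sup>2) \<le> V" using s by (intro sep) auto
  moreover note prob_smoothed_approx[OF s(1) \<alpha> \<epsilon>] prob_smoothed_approx[OF Ks(1) \<alpha> \<epsilon>]
  ultimately have "\<forall>\<^sub>F y in sequentially. a < y \<and> (1 \<le> (\<Sum>p\<in>primes_in 0 y. (pw s p - pw (K * s) p)\<^sup>2) \<and>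
        (\<Sum>p\<in>primes_in 0 y. (pw s p)\<^sup>2 - (pw (K * s) p)\<^sup>2) \<le> V) \<and>
      (\<exists>N. prob {\<omega>\<in>space M. \<not> (euler s 0 y \<omega> / 2 \<le> smoothed \<alpha> N s \<omega> \<and> smoothed \<alpha> N s \<omega> \<le> 2 * euler s 0 y \<omega>)} \<le> \<epsilon> \<and>
        prob {\<omega>\<in>space M. \<not> (euler (K * s) 0 y \<omega> / 2 \<le> smoothed \<alpha> N (K * s) \<omega> \<and> smoothed \<alpha> N (K * s) \<omega> \<le> 2 * euler (K * s) 0 y \<omega>)} \<le> \<epsilon>)"
  proof eventually_elim
    case (elim y)
    then show ?case using eventually_happens'[OF sequentially_bot eventually_conj[OF elim(3,4)]] by blast
  qed
  then obtain y N where y: "a < y" "1 \<le> (\<Sum>p\<in>primes_in 0 y. (pw s p - pw (K * s) p)\<^sup>2)"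
        "(\<Sum>p\<in>primes_in 0 y. (pw s p)\<^sup>2 - (pw (K * s) p)\<^sup>2) \<le> V"
      and N: "prob {\<omega>\<in>space M. \<not> (euler s 0 y \<omega> / 2 \<le> smoothed \<alpha> N s \<omega> \<and> smoothed \<alpha> N s \<omega> \<le> 2 * euler s 0 y \<omega>)} \<le> \<epsilon>"
        "prob {\<omega>\<in>space M. \<not> (euler (K * s) 0 y \<omega> / 2 \<le> smoothed \<alpha> N (K * s) \<omega> \<and> smoothed \<alpha> N (K * s) \<omega> \<le> 2 * euler (K * s) 0 y \<omega>)} \<le> \<epsilon>"
    using eventually_happens'[OF sequentially_bot] by blast
  have "prob {\<omega>\<in>space M. euler (K * s) 0 y \<omega> < real k * s} \<le> 
      prob {\<omega>\<in>space M. euler (K * s) 0 y \<omega> < exp (-7/2) * (K * s) powr (3/4)}"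
    using ks by (intro finite_measure_mono) (auto intro: less_le_trans)
  also have "\<dots> \<le> exp 1 * (K * s) powr (1/256)" using s Ks by (intro prob_euler_small) auto
  also have "\<dots> \<le> \<epsilon>" using s by simp
  finally have small: "prob {\<omega>\<in>space M. euler (K * s) 0 y \<omega> < real k * s} \<le> \<epsilon>" .
  have "prob (exceptional \<alpha> K k s y N) \<le> \<epsilon> + \<epsilon> + \<epsilon>"
    unfolding exceptional_def
    by (intro order.trans[OF measure_Un_le] add_mono N small) measurable
  also have "\<dots> = (1/2)^k" by (simp add: \<epsilon>_def)
  finally have "prob (exceptional \<alpha> K k s y N) \<le> (1/2)^k" .
  moreover have "exp (- 1024 * (c + 1)\<^sup>2 * V) / 4 \<le> prob {\<omega>\<in>space M. c \<le> block_sum K s a y \<omega>}"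
    "exp (- 1024 * (c + 1)\<^sup>2 * V) / 4 \<le> prob {\<omega>\<in>space M. block_sum K s a y \<omega> \<le> - c}"
    using prob_block_sum_ge[of c s K a y V] c s K y by (simp_all add: mult_ac)
  moreover have "block_sum K s a y \<omega> - 1 - V \<le> ln (euler s 0 y \<omega>) - ln (euler (K * s) 0 y \<omega>) \<and>
         ln (euler s 0 y \<omega>) - ln (euler (K * s) 0 y \<omega>) \<le> block_sum K s a y \<omega> + 1" for \<omega>
    using ln_euler_ratio_bounds[of s K a y V \<omega>] s K y by (simp add: mult_ac)
  moreover have "2 * s \<le> 1" using s Ks by linarith
  ultimately show ?thesis using s(1) y(1) by blast
qed

end

section \<open>Sign changes\<close>

text \<open>By continuity from above, the upper limit of the events still has probability at least
  \<open>\<delta>\<close>, and the 0-1 law then leaves only the value 1.\<close>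

lemma (in prob_space) AE_infinitely_many_events:
  assumes F: "indep_events F UNIV" and \<delta>: "0 < \<delta>" "\<And>n::nat. \<delta> \<le> prob (F n)"
  shows "AE \<omega> in M. \<exists>\<^sub>\<infinity>n. \<omega> \<in> F n"
proof -
  have ev: "F n \<in> events" for n using F by (auto simp: indep_events_def)
  let ?U = "\<lambda>n. \<Union>m\<in>{n..}. F m"
  have evU: "?U n \<in> events" for n by (intro sets.countable_UN'' ev) auto
  have "decseq ?U" by (intro decseq_SucI UN_mono) auto
  then have "(\<lambda>n. prob (?U n)) \<longlonglongrightarrow> prob (\<Inter>n. ?U n)"
    using evU by (intro finite_Lim_measure_decseq) auto
  moreover have "\<delta> \<le> prob (?U n)" for n
  proof -
    have "prob (F n) \<le> prob (?U n)" using evU by (intro finite_measure_mono) auto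
    then show ?thesis using \<delta>(2)[of n] by linarith
  qed
  ultimately have "\<delta> \<le> prob (\<Inter>n. ?U n)" by (intro LIMSEQ_le_const) auto
  then have "prob (\<Inter>n. ?U n) = 1" using borel_0_1_law[OF F] \<delta>(1) by auto
  moreover have "(\<Inter>n. ?U n) \<in> events" using evU by (intro sets.countable_INT') auto
  ultimately have "AE \<omega> in M. \<omega> \<in> (\<Inter>n. ?U n)" by (simp only: prob_eq_1)
  then show ?thesis by (rule AE_mp) (auto simp: INFM_nat_le)
qed

context random_signs
begin

lemma indep_events_blocks:
  assumes "disjoint_family I" "\<And>k p. p \<in> I k \<Longrightarrow> prime p" "\<And>k. A k \<in> sets borel"
  shows "indep_events (\<lambda>k. {\<omega>\<in>space M. (\<Sum>p\<in>I k. a k p * e p \<omega>) \<in> A k}) (UNIV :: nat set)"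
proof -
  have "indep_vars (\<lambda>k. PiM (I k) (\<lambda>_. borel)) (\<lambda>k \<omega>. restrict (\<lambda>p. e p \<omega>) (I k)) (UNIV :: nat set)"
    using assms by (intro indep_vars_restrict[OF indep]) auto
  then have "indep_vars (\<lambda>_. borel) (\<lambda>k \<omega>. \<Sum>p\<in>I k. a k p * restrict (\<lambda>p. e p \<omega>) (I k) p) (UNIV :: nat set)"
    by (rule indep_vars_compose2) measurable
  then have "indep_vars (\<lambda>_. borel) (\<lambda>k \<omega>. \<Sum>p\<in>I k. a k p * e p \<omega>) (UNIV :: nat set)"
    by (simp cong: sum.cong)
  from indep_eventsI_indep_vars[OF this, of "\<lambda>k x. x \<in> A k"] assms(3) show ?thesis by simp
qed

theorem AE_changes_sign:
  assumes \<alpha>: "0 \<le> \<alpha>" "\<alpha> \<le> 1/2"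
  shows "AE \<omega> in M. changes_sign_infinitely_often (weighted_partial_sum (\<lambda>n. random_mult e n \<omega>) \<alpha>)"
proof -
  obtain K V :: real where K: "1 < K" and V: "0 < V" and
    sep: "\<And>s. 0 < s \<Longrightarrow> 2 * K * s \<le> 1 \<Longrightarrow> \<forall>\<^sub>F y in sequentially.
        1 \<le> (\<Sum>p\<in>primes_in 0 y. (pw s p - pw (K * s) p)\<^sup>2) \<and>
        (\<Sum>p\<in>primes_in 0 y. (pw s p)\<^sup>2 - (pw (K * s) p)\<^sup>2) \<le> V"
    using separation_constants by blast
  \<comment> \<open>After the loss \<open>1 + V\<close> from the deterministic part and the small
    primes, a block beyond \<open>c\<close> or \<open>- c\<close> moves the ratio of Euler products
    by a factor \<open>16 * K\<close>. The sign comparison loses 4 through the two approximations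
    and up to \<open>K\<close> through the quotient of exponents; the rest is margin for the error
    term.\<close>
  define c where "c = ln (16 * K) + 1 + V"
  have lnK: "0 < ln (16 * K)" using K by (intro ln_gt_zero) simp
  have c: "0 < c" using lnK V by (simp add: c_def)
  define \<delta> where "\<delta> = exp (- 1024 * (c + 1)\<^sup>2 * V) / 4"
  have \<delta>: "0 < \<delta>" by (simp add: \<delta>_def)
  define good where "good k a s y N \<longleftrightarrow> 0 < s \<and> 2 * s \<le> 1 \<and> a < y \<and> prob (exceptional \<alpha> K k s y N) \<le> (1/2)^k \<and>
    \<delta> \<le> prob {\<omega>\<in>space M. c \<le> block_sum K s a y \<omega>} \<and>
    \<delta> \<le> prob {\<omega>\<in>space M. block_sum K s a y \<omega> \<le> - c} \<and>
    (\<forall>\<omega>. block_sum K s a y \<omega> - 1 - V \<le> ln (euler s 0 y \<omega>) - ln (euler (K * s) 0 y \<omega>) \<and>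
         ln (euler s 0 y \<omega>) - ln (euler (K * s) 0 y \<omega>) \<le> block_sum K s a y \<omega> + 1)" for k a s y N
  have good_ex: "\<exists>s y N. good k a s y N" for k a
    using scale_exists[OF \<alpha>(2) K c sep, of a k] unfolding good_def \<delta>_def by blast
  \<comment> \<open>Scales are chosen recursively. Each block of primes starts where the previous
    one ended, so the blocks are disjoint and the events on them independent.\<close>
  have "\<exists>f. \<forall>k. (case f k of (a, s, y, N) \<Rightarrow> good k a s y N) \<and> fst (f (Suc k)) = (case f k of (a, s, y, N) \<Rightarrow> y)"
  proof (rule dependent_nat_choice)
    show "\<exists>x. case x of (a, s, y, N) \<Rightarrow> good 0 a s y N" using good_ex[of 0 0] by auto
    show "\<exists>z. (case z of (a, s, y, N) \<Rightarrow> good (Suc k) a s y N) \<and> fst z = (case x of (a, s, y, N) \<Rightarrow> y)" for x k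
      using good_ex[of "Suc k" "case x of (a, s, y, N) \<Rightarrow> y"] by (auto split: prod.splits)
  qed
  then obtain f where f: "\<forall>k. (case f k of (a, s, y, N) \<Rightarrow> good k a s y N) \<and>
      fst (f (Suc k)) = (case f k of (a, s, y, N) \<Rightarrow> y)" by (rule exE)
  define a s y N where "a k = fst (f k)" and "s k = fst (snd (f k))" and "y k = fst (snd (snd (f k)))"
    and "N k = snd (snd (snd (f k)))" for k
  have good: "good k (a k) (s k) (y k) (N k)" and a_Suc: "a (Suc k) = y k" for k
    using spec[OF f, of k] by (auto simp: a_def s_def y_def N_def split: prod.splits)
  have s: "0 < s k" "2 * s k \<le> 1" and ay: "a k < y k" for k using good[of k] by (auto simp: good_def)
  have ya: "y j \<le> a k" if "j < k" for j k
    using that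
  proof (induction k)
    case (Suc k)
    show ?case
    proof (cases "j = k")
      case False
      then show ?thesis using Suc ay[of k] by (simp add: a_Suc)
    qed (simp add: a_Suc)
  qed simp
  have disj: "disjoint_family (\<lambda>k. primes_in (a k) (y k))"
    unfolding disjoint_family_on_def
  proof (intro ballI impI)
    fix j k :: nat assume "j \<noteq> k"
    then show "primes_in (a j) (y j) \<inter> primes_in (a k) (y k) = {}"
      using ya[of j k] ya[of k j] by (cases "j < k") (auto simp: primes_in_def)
  qed
  have inf_up: "AE \<omega> in M. \<exists>\<^sub>\<infinity>k. \<omega> \<in> {\<omega>\<in>space M. c \<le> block_sum K (s k) (a k) (y k) \<omega>}"
  proof (rule AE_infinitely_many_events[OF _ \<delta>])
    show "indep_events (\<lambda>k. {\<omega>\<in>space M. c \<le> block_sum K (s k) (a k) (y k) \<omega>}) UNIV"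
      using indep_events_blocks[OF disj, of "\<lambda>_. {c..}" "\<lambda>k. log_coeff K (s k)"]
      by (simp add: block_sum_def primes_inD)
  qed (use good in \<open>auto simp: good_def\<close>)
  have inf_down: "AE \<omega> in M. \<exists>\<^sub>\<infinity>k. \<omega> \<in> {\<omega>\<in>space M. block_sum K (s k) (a k) (y k) \<omega> \<le> - c}"
  proof (rule AE_infinitely_many_events[OF _ \<delta>])
    show "indep_events (\<lambda>k. {\<omega>\<in>space M. block_sum K (s k) (a k) (y k) \<omega> \<le> - c}) UNIV"
      using indep_events_blocks[OF disj, of "\<lambda>_. {..-c}" "\<lambda>k. log_coeff K (s k)"]
      by (simp add: block_sum_def primes_inD)
  qed (use good in \<open>auto simp: good_def\<close>)
  \<comment> \<open>The exceptional events of different scales may depend on each other, but their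
    probabilities are summable, so almost surely only finitely many occur.\<close>
  have "AE \<omega> in M. \<forall>\<^sub>F k in sequentially. \<omega> \<in> space M - exceptional \<alpha> K k (s k) (y k) (N k)"
  proof (rule borel_cantelli_AE1)
    have "summable (\<lambda>k. (1/2::real)^k)" by (rule summable_geometric) simp
    then show "summable (\<lambda>k. prob (exceptional \<alpha> K k (s k) (y k) (N k)))"
      by (rule summable_comparison_test'[where N = 0]) (use good in \<open>auto simp: good_def\<close>)
  qed (auto simp: emeasure_eq_measure)
  with inf_up inf_down show ?thesis
  proof eventually_elim
    case (elim \<omega>)
    let ?M = "\<lambda>n. \<Sum>m=1..n. random_mult e m \<omega> / real m powr \<alpha>"
    let ?P = "\<lambda>t k. euler t 0 (y k) \<omega>" and ?D = "\<lambda>t k. smoothed \<alpha> (N k) t \<omega>"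
    have M_eq: "weighted_partial_sum (\<lambda>n. random_mult e n \<omega>) \<alpha> (real n) = ?M n" for n
      by (simp add: weighted_partial_sum_def)
    have pos: "0 < ?P (s k) k" "0 < ?P (K * s k) k" for k
      using s[of k] K by (auto intro!: euler_pos)
    have ratio_up: "16 * ?P (K * s k) k \<le> ?P (s k) k" if "c \<le> block_sum K (s k) (a k) (y k) \<omega>" for k
    proof -
      have "ln (16 * K) \<le> ln (?P (s k) k) - ln (?P (K * s k) k)"
      proof -
        have "block_sum K (s k) (a k) (y k) \<omega> - 1 - V \<le> ln (?P (s k) k) - ln (?P (K * s k) k)"
          using good[of k] unfolding good_def by blast
        then show ?thesis using that unfolding c_def by linarith
      qed
      moreover have "ln 16 \<le> ln (16 * K)" using K by (subst ln_le_cancel_iff) auto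
      ultimately have "ln (16 * ?P (K * s k) k) \<le> ln (?P (s k) k)"
        using pos[of k] by (simp add: ln_mult)
      then show ?thesis using pos[of k] by simp
    qed
    have ratio_down: "16 * K * ?P (s k) k \<le> ?P (K * s k) k" if "block_sum K (s k) (a k) (y k) \<omega> \<le> - c" for k
    proof -
      have "ln (?P (s k) k) - ln (?P (K * s k) k) \<le> - ln (16 * K)"
      proof -
        have "ln (?P (s k) k) - ln (?P (K * s k) k) \<le> block_sum K (s k) (a k) (y k) \<omega> + 1"
          using good[of k] unfolding good_def by blast
        then show ?thesis using that V unfolding c_def by linarith
      qed
      then have "ln (16 * K * ?P (s k) k) \<le> ln (?P (K * s k) k)"
        using pos[of k] K by (simp add: ln_mult)
      then show ?thesis using pos[of k] K by simp
    qed
    \<comment> \<open>The factor \<open>\<sigma>\<close> covers both constant signs at once. The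
      error is \<open>s k\<close> times a quantity that does not depend on \<open>k\<close>.\<close>
    have compare: "(1/2 - \<alpha> + s k) / (1/2 - \<alpha> + K * s k) * (\<sigma> * ?D (K * s k) k) - 
        (K - 1) * s k * (\<Sum>n=1..n0. \<bar>?M n\<bar>) \<le> \<sigma> * ?D (s k) k"
      if \<sigma>: "\<sigma> = 1 \<or> \<sigma> = -1" and M: "\<And>n. n0 \<le> n \<Longrightarrow> 0 \<le> \<sigma> * ?M n" for \<sigma> n0 k
    proof -
      have "(1/2 - \<alpha> + s k) / (1/2 - \<alpha> + K * s k) * (\<Sum>n=1..N k. (\<sigma> * ?M n) * step_weight (1/2 - \<alpha> + K * s k) n) -
        ((1/2 - \<alpha> + K * s k) - (1/2 - \<alpha> + s k)) * (\<Sum>n=1..n0. \<bar>\<sigma> * ?M n\<bar>) \<le> 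
        (\<Sum>n=1..N k. (\<sigma> * ?M n) * step_weight (1/2 - \<alpha> + s k) n)"
        using s[of k] \<alpha> K M by (intro step_weight_sum_compare) (auto simp: mult_le_cancel_right1)
      moreover have "\<bar>\<sigma> * ?M n\<bar> = \<bar>?M n\<bar>" for n using \<sigma> by (auto simp: abs_mult)
      moreover have "(\<Sum>n=1..N k. (\<sigma> * ?M n) * step_weight (1/2 - \<alpha> + t) n) = \<sigma> * ?D t k" for t
        unfolding smoothed_def by (subst sum_distrib_left) (simp only: mult.assoc)
      moreover have "(1/2 - \<alpha> + K * s k) - (1/2 - \<alpha> + s k) = (K - 1) * s k" by (simp add: algebra_simps)
      ultimately show ?thesis by simp
    qed
    \<comment> \<open>The quotient equals \<open>1 / K\<close> for \<open>\<alpha> = 1/2\<close> and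
      tends to 1 with \<open>s k\<close> tending to 0 for smaller \<open>\<alpha>\<close>; these
      bounds cover all cases.\<close>
    have r: "1 / K \<le> (1/2 - \<alpha> + s k) / (1/2 - \<alpha> + K * s k)" "(1/2 - \<alpha> + s k) / (1/2 - \<alpha> + K * s k) \<le> 1" for k
    proof -
      define A B where "A = 1/2 - \<alpha> + s k" and "B = 1/2 - \<alpha> + K * s k"
      have "s k < K * s k" using s[of k] K by simp
      moreover have "1/2 - \<alpha> \<le> K * (1/2 - \<alpha>)" using K \<alpha> mult_right_mono[of 1 K "1/2 - \<alpha>"] by simp
      moreover have "K * A = K * (1/2 - \<alpha>) + K * s k" by (simp only: A_def distrib_left)
      ultimately have "0 < B" "B \<le> K * A" "A \<le> B"
        using s[of k] \<alpha> unfolding A_def B_def by linarith+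
      then show "1 / K \<le> (1/2 - \<alpha> + s k) / (1/2 - \<alpha> + K * s k)" "(1/2 - \<alpha> + s k) / (1/2 - \<alpha> + K * s k) \<le> 1"
        using K unfolding A_def[symmetric] B_def[symmetric] by (auto simp: field_simps)
    qed
    have approx: "\<forall>\<^sub>F k in sequentially. ?P (s k) k / 2 \<le> ?D (s k) k \<and> ?D (s k) k \<le> 2 * ?P (s k) k \<and>
      ?P (K * s k) k / 2 \<le> ?D (K * s k) k \<and> ?D (K * s k) k \<le> 2 * ?P (K * s k) k \<and> real k * s k \<le> ?P (K * s k) k"
      using elim(3) by eventually_elim (auto simp: exceptional_def)
    have large: "\<forall>\<^sub>F k in sequentially. C < real k" for C :: real
      using filterlim_real_sequentially by (simp add: filterlim_at_top_dense)
    \<comment> \<open>If the sums are eventually nonnegative, the product at \<open>K * s k\<close>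
      is at most \<open>4 * K\<close> times the one at \<open>s k\<close> plus an error. At a scale
      with a very negative block and \<open>k\<close> large, each of the two terms is at most a
      quarter of the left side.\<close>
    have not_nonneg: False if M: "\<And>n. n0 \<le> n \<Longrightarrow> 0 \<le> ?M n" for n0
    proof -
      define C where "C = (\<Sum>n=1..n0. \<bar>?M n\<bar>)"
      have C: "0 \<le> C" by (simp add: C_def sum_nonneg)
      note ev = frequently_eventually_frequently[OF elim(2)
          eventually_conj[OF approx large[of "8 * K * K * C"], folded cofinite_eq_sequentially]]
      from frequently_ex[OF ev] obtain k where k: "?D (s k) k \<le> 2 * ?P (s k) k" "?P (K * s k) k / 2 \<le> ?D (K * s k) k"
        "real k * s k \<le> ?P (K * s k) k" "8 * K * K * C < real k" "block_sum K (s k) (a k) (y k) \<omega> \<le> - c"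
        by blast
      have "1 / K * (?P (K * s k) k / 2) \<le> (1/2 - \<alpha> + s k) / (1/2 - \<alpha> + K * s k) * ?D (K * s k) k"
        using r(1)[of k] order.trans[OF _ r(1)[of k], of 0] k(2) pos(2)[of k] K by (intro mult_mono) auto
      also have "\<dots> \<le> ?D (s k) k + (K - 1) * s k * C"
        using compare[of 1 n0 k] M by (simp add: C_def)
      also have "?D (s k) k \<le> 2 * ?P (s k) k" by fact
      finally have "?P (K * s k) k \<le> 4 * K * ?P (s k) k + 2 * K * ((K - 1) * s k * C)"
        using K by (simp add: field_simps)
      also have "4 * K * ?P (s k) k \<le> ?P (K * s k) k / 4" using ratio_down[OF k(5)] by simp
      also have "2 * K * ((K - 1) * s k * C) \<le> 2 * K * (K * s k * C)"
        using K s[of k] C by (intro mult_left_mono mult_right_mono) auto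
      finally have "?P (K * s k) k \<le> 4 * (K * (K * (s k * C)))" 
        using pos(2)[of k] by (simp add: mult.assoc)
      moreover have "8 * K * K * C * s k \<le> real k * s k" using k(4) s[of k] by (intro mult_right_mono) auto
      ultimately have "?P (K * s k) k \<le> ?P (K * s k) k / 2" using k(3) by (simp add: mult_ac)
      then show False using pos(2)[of k] by simp
    qed
    \<comment> \<open>If the sums are eventually nonpositive, the product at \<open>s k\<close> is
      at most 6 times the one at \<open>K * s k\<close>, with 4 from the approximations and 2 from
      the error. A scale with a large block forces a factor of at least 16.\<close>
    have not_nonpos: False if M: "\<And>n. n0 \<le> n \<Longrightarrow> ?M n \<le> 0" for n0
    proof -
      define C where "C = (\<Sum>n=1..n0. \<bar>?M n\<bar>)"
      have C: "0 \<le> C" by (simp add: C_def sum_nonneg)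
      note ev = frequently_eventually_frequently[OF elim(1)
          eventually_conj[OF approx large[of "K * C"], folded cofinite_eq_sequentially]]
      from frequently_ex[OF ev] obtain k where k: "?P (s k) k / 2 \<le> ?D (s k) k" "?P (K * s k) k / 2 \<le> ?D (K * s k) k" "?D (K * s k) k \<le> 2 * ?P (K * s k) k"
        "real k * s k \<le> ?P (K * s k) k" "K * C < real k" "c \<le> block_sum K (s k) (a k) (y k) \<omega>"
        by blast
      have "?P (s k) k / 2 \<le> ?D (s k) k" by fact
      also have "\<dots> \<le> (1/2 - \<alpha> + s k) / (1/2 - \<alpha> + K * s k) * ?D (K * s k) k + (K - 1) * s k * C"
        using compare[of "-1" n0 k] M by (simp add: C_def)
      also have "(1/2 - \<alpha> + s k) / (1/2 - \<alpha> + K * s k) * ?D (K * s k) k \<le> 1 * ?D (K * s k) k"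
        using r(2)[of k] k(2) pos(2)[of k] by (intro mult_right_mono) auto
      also have "1 * ?D (K * s k) k \<le> 2 * ?P (K * s k) k" using k(3) by simp
      also have "(K - 1) * s k * C \<le> K * s k * C"
        using K s[of k] C by (intro mult_right_mono) auto
      finally have "?P (s k) k / 2 \<le> 2 * ?P (K * s k) k + K * C * s k" by (simp add: mult_ac)
      also have "K * C * s k \<le> real k * s k" using k(5) s[of k] by (intro mult_right_mono) auto
      also have "real k * s k \<le> ?P (K * s k) k" by fact
      finally show False using ratio_up[OF k(6)] pos(2)[of k] by simp
    qed
    show ?case unfolding changes_sign_infinitely_often_def
    proof (intro allI conjI notI)
      fix x0 assume *: "\<forall>x\<ge>x0. 0 \<le> weighted_partial_sum (\<lambda>n. random_mult e n \<omega>) \<alpha> x"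
      have "0 \<le> ?M n" if "nat \<lceil>x0\<rceil> \<le> n" for n
        using *[rule_format, of "real n"] that unfolding M_eq by linarith
      then show False by (rule not_nonneg)
    next
      fix x0 assume *: "\<forall>x\<ge>x0. weighted_partial_sum (\<lambda>n. random_mult e n \<omega>) \<alpha> x \<le> 0"
      have "?M n \<le> 0" if "nat \<lceil>x0\<rceil> \<le> n" for n
        using *[rule_format, of "real n"] that unfolding M_eq by linarith
      then show False by (rule not_nonpos)
    qed
  qed
qed

end

section \<open>From almost sure signs to signs at every point\<close>

theorem theorem1p1:
  fixes M :: "'a measure" and X :: "nat \<Rightarrow> 'a \<Rightarrow> real" and \<alpha> :: real
  assumes "prob_space M"
    and "prob_space.indep_vars M (\<lambda>_. borel) X {p. prime p}"
    and "\<And>p. prime p \<Longrightarrow> measure M {\<omega> \<in> space M. X p \<omega> = 1} = 1 / 2"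
    and "\<And>p. prime p \<Longrightarrow> measure M {\<omega> \<in> space M. X p \<omega> = - 1} = 1 / 2"
    and "0 \<le> \<alpha>" and "\<alpha> \<le> 1 / 2"
  shows "AE \<omega> in M. changes_sign_infinitely_often
           (weighted_partial_sum (\<lambda>n. random_mult X n \<omega>) \<alpha>)"
proof -
  interpret prob_space M by fact
  \<comment> \<open>Every value other than 1 is sent to -1. At a prime this alters \<open>X\<close>
    only on a null set and yields a sign at every sample point.\<close>
  define e where "e p \<omega> = (if X p \<omega> = 1 then 1 else -1 :: real)" for p \<omega>
  have X_meas: "X p \<in> borel_measurable M" if "prime p" for p
    using assms(2) that by (auto simp: indep_vars_def)
  interpret random_signs M e
  proof
    show "indep_vars (\<lambda>_. borel) e {p. prime p}"
      unfolding e_def[abs_def] by (rule indep_vars_compose2[OF assms(2)]) measurable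
    show "e p \<omega> = 1 \<or> e p \<omega> = -1" for p \<omega> by (simp add: e_def)
    show "expectation (e p) = 0" if p: "prime p" for p
    proof -
      let ?A = "{\<omega> \<in> space M. X p \<omega> = 1}"
      have A: "?A \<in> events" using X_meas[OF p] by measurable
      have "expectation (e p) = expectation (\<lambda>\<omega>. 2 * indicator ?A \<omega> - 1)"
        by (intro Bochner_Integration.integral_cong) (auto simp: e_def)
      also have "\<dots> = 2 * prob ?A - 1" using A by (simp add: prob_space emeasure_eq_measure)
      finally show ?thesis using assms(3)[OF p] by simp
    qed
  qed
  \<comment> \<open>There are countably many primes, so one null set serves them all.\<close>
  have "AE \<omega> in M. \<forall>p\<in>{p. prime p}. X p \<omega> = e p \<omega>"
  proof (rule AE_ball_countable')
    fix p :: nat assume "p \<in> {p. prime p}"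
    then have p: "prime p" by simp
    let ?A = "{\<omega> \<in> space M. X p \<omega> = 1}" and ?B = "{\<omega> \<in> space M. X p \<omega> = -1}"
    have AB: "?A \<in> events" "?B \<in> events" using X_meas[OF p] by measurable
    have "prob (?A \<union> ?B) = prob ?A + prob ?B" using AB by (intro finite_measure_Union) auto
    then have "prob (?A \<union> ?B) = 1" using assms(3,4)[OF p] by simp
    then have "AE \<omega> in M. \<omega> \<in> ?A \<union> ?B" using AB by (subst (asm) prob_eq_1) auto
    then show "AE \<omega> in M. X p \<omega> = e p \<omega>" by (rule AE_mp) (auto simp: e_def)
  qed simp
  with AE_changes_sign[OF assms(5,6)] show ?thesis
  proof eventually_elim
    case (elim \<omega>)
    have "random_mult X n \<omega> = random_mult e n \<omega>" for n
      using elim(2) by (auto simp: random_mult_def intro!: prod.cong)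
    then show ?case using elim(1) by simp
  qed
qed

end
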